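(* Let $\phi,\psi$ be a pair of Dirichlet series in the class $\mathcal{A}$ with parameter $r>0$ (see context), let $\rho$ be the residue of $\phi$ at $s=r$ (with $\rho=0$ if there is no pole), and let $\phi(0)$ denote the value of the continuation of $\phi$ at $0$. Then for every $\alpha\in\mathbb{C}$ with $\mathrm{Re}(\alpha)>0$ and every $\beta\in\mathbb{C}$, \[ \sum_{n=1}^{\infty}a(n)\lambda_{n}^{\frac{1-r}{2}}e^{-\alpha\lambda_{n}}J_{r-1}(\beta\sqrt{\lambda_{n}})=\frac{\phi(0)\beta^{r-1}}{2^{r-1}\Gamma(r)}+\frac{\beta^{r-1}\rho}{2^{r-1}\alpha^{r}}e^{-\frac{\beta^{2}}{4\alpha}}+\frac{e^{-\frac{\beta^{2}}{4\alpha}}}{\alpha}\sum_{n=1}^{\infty}b(n)\mu_{n}^{\frac{1-r}{2}}e^{-\mu_{n}/\alpha}I_{r-1}\!\left(\frac{\beta\sqrt{\mu_{n}}}{\alpha}\right). \]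
   Context: Let $(\lambda_n),(\mu_n)$ be sequences of positive reals strictly increasing to $\infty$, and $(a(n)),(b(n))$ complex sequences not identically zero. Let $\phi(s)=\sum_{n\ge1}a(n)\lambda_n^{-s}$ and $\psi(s)=\sum_{n\ge1}b(n)\mu_n^{-s}$ have finite abscissas of absolute convergence $\sigma_a,\sigma_b$. They satisfy Hecke's functional equation $\Gamma(s)\phi(s)=\Gamma(r-s)\psi(r-s)$ ($r>0$) if there is a meromorphic function $\chi(s)$ with $\chi(s)=\Gamma(s)\phi(s)$ for $\mathrm{Re}(s)>\sigma_a$, $\chi(s)=\Gamma(r-s)\psi(r-s)$ for $\mathrm{Re}(s)<r-\sigma_b$, $\chi(s)\to0$ as $|\mathrm{Im}(s)|\to\infty$ uniformly in every vertical strip $\sigma_1\le\mathrm{Re}(s)\le\sigma_2$, and whose singularities are poles confined to a compact set. The pair belongs to class $\mathcal{A}$ if moreover $\phi$ and $\psi$ extend analytically to $\mathbb{C}$ except for possible simple poles at $s=r$ (residues $\rho,\rho^\star$). $J_\nu$, $I_\nu$ are the Bessel and modified Bessel functions of the first kind; non-integer powers use principal branches.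
   Formalization: With principal branches the identity fails for non-integer r when Arg β − Arg α is outside (−π, π]; it is proved for all α, β with the factor (β√μ_n/(2α))^{r−1} of I_{r−1} read as (β√μ_n/2)^{r−1}/α^{r−1}, and literally when r is an integer or Arg β − Arg α lies in (−π, π]. *)

theory Defs
  imports "HOL-Complex_Analysis.Complex_Analysis"
begin

text \<open>
  All sequences are indexed from 0: \<open>a n\<close> and \<open>lam n\<close> are the coefficient and the
  frequency of the \<open>(n+1)\<close>-st term of the series.
\<close>

definition gen_dirichlet :: "(nat \<Rightarrow> complex) \<Rightarrow> (nat \<Rightarrow> real) \<Rightarrow> complex \<Rightarrow> complex" where
  "gen_dirichlet a lam s = (\<Sum>n. a n * complex_of_real (lam n) powr (- s))"

definition abs_abscissa :: "(nat \<Rightarrow> complex) \<Rightarrow> (nat \<Rightarrow> real) \<Rightarrow> ereal" where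
  "abs_abscissa a lam =
     Inf (ereal ` {\<sigma>. summable (\<lambda>n. norm (a n * complex_of_real (lam n) powr (- of_real \<sigma>)))})"

definition dirichlet_data :: "(nat \<Rightarrow> complex) \<Rightarrow> (nat \<Rightarrow> real) \<Rightarrow> bool" where
  "dirichlet_data a lam \<longleftrightarrow>
     (\<forall>n. lam n > 0) \<and> strict_mono lam \<and> filterlim lam at_top sequentially \<and>
     (\<exists>n. a n \<noteq> 0) \<and> \<bar>abs_abscissa a lam\<bar> \<noteq> \<infinity>"

text \<open>
  The products of Gamma function and Dirichlet series are compared with \<open>X\<close> only off the
  poles of the Gamma factor: there HOL's value of \<open>Gamma\<close> is 0 by convention, while
  \<open>X\<close> may be singular. (Such points lie in the half-planes only if an abscissa is negative.)
\<close>

definition hecke_equation ::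
    "real \<Rightarrow> (nat \<Rightarrow> complex) \<Rightarrow> (nat \<Rightarrow> real) \<Rightarrow> (nat \<Rightarrow> complex) \<Rightarrow> (nat \<Rightarrow> real) \<Rightarrow> bool" where
  "hecke_equation r a lam b mu \<longleftrightarrow>
     (\<exists>X. X meromorphic_on UNIV \<and>
        (\<exists>K. compact K \<and> X analytic_on (- K)) \<and>
        (\<forall>s. ereal (Re s) > abs_abscissa a lam \<longrightarrow> s \<notin> \<int>\<^sub>\<le>\<^sub>0 \<longrightarrow>
             X s = Gamma s * gen_dirichlet a lam s) \<and>
        (\<forall>s. ereal (Re s) < ereal r - abs_abscissa b mu \<longrightarrow> of_real r - s \<notin> \<int>\<^sub>\<le>\<^sub>0 \<longrightarrow>
             X s = Gamma (of_real r - s) * gen_dirichlet b mu (of_real r - s)) \<and>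
        (\<forall>\<sigma>1 \<sigma>2. \<forall>\<epsilon>>0. \<exists>T. \<forall>s. \<sigma>1 \<le> Re s \<longrightarrow> Re s \<le> \<sigma>2 \<longrightarrow> \<bar>Im s\<bar> \<ge> T \<longrightarrow> norm (X s) < \<epsilon>))"

definition extends_with_simple_pole ::
    "(complex \<Rightarrow> complex) \<Rightarrow> (nat \<Rightarrow> complex) \<Rightarrow> (nat \<Rightarrow> real) \<Rightarrow> real \<Rightarrow> bool" where
  "extends_with_simple_pole F a lam r \<longleftrightarrow>
     F analytic_on (- {of_real r}) \<and>
     (F analytic_on {of_real r} \<or> is_pole F (of_real r) \<and> zorder F (of_real r) = -1) \<and>
     (\<forall>s. ereal (Re s) > abs_abscissa a lam \<longrightarrow> F s = gen_dirichlet a lam s)"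

text \<open>
  Class \<open>\<A>\<close>; \<open>\<Phi>\<close> and \<open>\<Psi>\<close> are the (unique, up to the value at a pole) continuations
  of the two Dirichlet series.
\<close>

definition class_A ::
    "real \<Rightarrow> (nat \<Rightarrow> complex) \<Rightarrow> (nat \<Rightarrow> real) \<Rightarrow> (nat \<Rightarrow> complex) \<Rightarrow> (nat \<Rightarrow> real) \<Rightarrow>
     (complex \<Rightarrow> complex) \<Rightarrow> (complex \<Rightarrow> complex) \<Rightarrow> bool" where
  "class_A r a lam b mu \<Phi> \<Psi> \<longleftrightarrow>
     r > 0 \<and> dirichlet_data a lam \<and> dirichlet_data b mu \<and> hecke_equation r a lam b mu \<and>
     extends_with_simple_pole \<Phi> a lam r \<and> extends_with_simple_pole \<Psi> b mu r"

text \<open>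
  Principal power with \<open>0\<^sup>0 = 1\<close>; HOL's \<open>powr\<close> has \<open>0 powr 0 = 0\<close>, which would
  give the wrong value \<open>J\<^sub>0(0) = 0\<close>. For \<open>z = 0\<close> and \<open>w \<noteq> 0\<close> the value is 0, which
  is a mere convention if \<open>Re w < 0\<close>.
\<close>

definition cpow :: "complex \<Rightarrow> complex \<Rightarrow> complex" where
  "cpow z w = (if z = 0 \<and> w = 0 then 1 else z powr w)"

definition bessel_J :: "complex \<Rightarrow> complex \<Rightarrow> complex" where
  "bessel_J \<nu> z =
     cpow (z / 2) \<nu> * (\<Sum>k. (-1) ^ k * rGamma (\<nu> + of_nat k + 1) / fact k * (z / 2) ^ (2 * k))"

text \<open>The series for \<open>I\<^sub>\<nu>(z)\<close> with \<open>p\<close> as the value of the multivalued factor \<open>(z/2)\<^sup>\<nu>\<close>.\<close>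

definition bessel_I_branch :: "complex \<Rightarrow> complex \<Rightarrow> complex \<Rightarrow> complex" where
  "bessel_I_branch p \<nu> z =
     p * (\<Sum>k. rGamma (\<nu> + of_nat k + 1) / fact k * (z / 2) ^ (2 * k))"

definition bessel_I :: "complex \<Rightarrow> complex \<Rightarrow> complex" where
  "bessel_I \<nu> z = bessel_I_branch (cpow (z / 2) \<nu>) \<nu> z"

text \<open>
  \<open>I\<^sub>\<nu>(z/w)\<close> for \<open>Re w > 0\<close>, with \<open>((z/w)/2)\<^sup>\<nu>\<close> read as \<open>(z/2)\<^sup>\<nu> / w\<^sup>\<nu>\<close>, both powers
  principal. For fixed \<open>z\<close> this is the analytic continuation in \<open>w\<close>, from the positive reals to
  the right half-plane, of \<open>w \<mapsto> bessel_I \<nu> (z / w)\<close>. It agrees with \<open>bessel_I \<nu> (z / w)\<close>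
  whenever \<open>-\<pi> < Arg z - Arg w \<le> \<pi>\<close> or \<open>\<nu>\<close> is a natural number, but otherwise differs from
  it by a factor \<open>exp (\<plusminus> 2 \<pi> \<i> \<nu>)\<close>.
\<close>

definition bessel_I_quot :: "complex \<Rightarrow> complex \<Rightarrow> complex \<Rightarrow> complex" where
  "bessel_I_quot \<nu> z w = bessel_I_branch (cpow (z / 2) \<nu> / w powr \<nu>) \<nu> (z / w)"

end

theory Submission
  imports Defs "HOL-Real_Asymp.Real_Asymp"
begin

text \<open>
  Write \<open>\<theta>\<^sub>a(z) = \<Sum> a(n) exp(-\<lambda>\<^sub>n z)\<close> for \<open>Re z > 0\<close>. The functional equation yields the modular
  relation \<open>\<theta>\<^sub>a(z) = \<phi>(0) + \<Gamma>(r) \<rho> z\<^sup>-\<^sup>r + z\<^sup>-\<^sup>r \<theta>\<^sub>b(1/z)\<close>. Instead of inverting a Mellin transform,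
  which would need vertical decay of \<open>\<Gamma>\<close>, let \<open>h\<close> be the difference of the two sides.
  The function \<open>H(s) = \<integral>\<^sub>0\<^sup>1 h(x) x\<^sup>s\<^sup>-\<^sup>1 dx\<close> continues to an entire function, since it equals \<open>X(s)\<close> without
  its polar parts minus the two entire integrals over \<open>(1,\<infinity>)\<close>. It is bounded in both outer
  half-planes by absolute convergence and in the middle strip because \<open>X \<rightarrow> 0\<close> there, hence
  constant by Liouville's theorem. So all moments of \<open>(1 - x) h(x) x\<^sup>K\<close> on \<open>(0,1)\<close> vanish,
  and \<open>h = 0\<close> by the Weierstrass approximation theorem and the identity theorem.

  For the Bessel series, put \<open>z = \<alpha>(1 + v)\<close> and apply to both sides of the modular relation the
  linear operation \<open>\<Sum> c\<^sub>k v\<^sup>k \<mapsto> \<Sum> c\<^sub>k w\<^sup>k / \<Gamma>(r + k)\<close>, where \<open>w = \<beta>\<^sup>2 / (4\<alpha>)\<close>. It takes \<open>exp(-x(1 + v))\<close>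
  to a \<open>J\<close>-Bessel series and \<open>(1 + v)\<^sup>-\<^sup>r exp(-x/(1 + v))\<close> to an \<open>I\<close>-Bessel series times
  \<open>exp(-x - w)\<close>, and Cauchy's estimate allows it to be applied term by term.
\<close>

section \<open>Reweighting power series coefficients\<close>

text \<open>A relation rather than an operator: convergence of the reweighted series is part of the
  claim, and only the germ of \<open>f\<close> at 0 matters. In the applications \<open>g\<close>
  decays faster than every geometric sequence, so \<open>w\<close> may be any complex number,
  however small \<open>\<delta>\<close> is.\<close>

definition coeff_transform ::
    "(nat \<Rightarrow> complex) \<Rightarrow> (complex \<Rightarrow> complex) \<Rightarrow> complex \<Rightarrow> complex \<Rightarrow> bool" where
  "coeff_transform g f w y \<longleftrightarrow>
     (\<exists>\<delta>>0. \<exists>c. (\<forall>v. norm v < \<delta> \<longrightarrow> (\<lambda>k. c k * v ^ k) sums f v) \<and> (\<lambda>k. g k * c k * w ^ k) sums y)"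

text \<open>The difference of the two expansions sums to 0 on a disc, while a power series with a
  nonzero coefficient has isolated zeros.\<close>

lemma power_series_coeffs_unique:
  fixes c c' :: "nat \<Rightarrow> complex"
  assumes "0 < \<delta>" "\<And>v. norm v < \<delta> \<Longrightarrow> (\<lambda>k. c k * v ^ k) sums f v"
    and "0 < \<delta>'" "\<And>v. norm v < \<delta>' \<Longrightarrow> (\<lambda>k. c' k * v ^ k) sums f' v"
    and "eventually (\<lambda>v. f v = f' v) (nhds 0)"
  shows "c = c'"
proof -
  obtain e where e: "e > 0" "\<And>v. norm v < e \<Longrightarrow> f v = f' v"
    using assms(5) by (auto simp: eventually_nhds_metric)
  define \<epsilon> where "\<epsilon> = min e (min \<delta> \<delta>')"
  have "\<epsilon> > 0" using assms e by (auto simp: \<epsilon>_def)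
  have "(\<lambda>k. (c k - c' k) * v ^ k) sums 0" if "norm v < \<epsilon>" for v
    using sums_diff[OF assms(2)[of v] assms(4)[of v]] that e(2)[of v]
    by (auto simp: \<epsilon>_def algebra_simps)
  then have sums0: "(\<lambda>k. (c k - c' k) * (v - 0) ^ k) sums 0" if "norm (v - 0) < \<epsilon>" for v
    using that by simp
  have "c m - c' m = 0" for m
  proof (rule ccontr)
    assume m: "c m - c' m \<noteq> 0"
    have "c 0 - c' 0 = 0" using sums0[of 0] \<open>\<epsilon> > 0\<close> by (simp del: right_minus_eq)
    with m have "m > 0" by (cases m) auto
    obtain s where "0 < s" "\<And>z. z \<in> cball (0::complex) s - {0} \<Longrightarrow> (0::complex) \<noteq> 0"
      using powser_0_nonzero[OF \<open>\<epsilon> > 0\<close> sums0 refl m \<open>m > 0\<close>] by blast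
    \<comment> \<open>\<open>of_real s\<close> is a point of the punctured closed disc on which the
      zero function would have to be nonzero.\<close>
    from this(1) this(2)[of "of_real s"] show False by simp
  qed
  then show ?thesis by auto
qed

lemma coeff_transformI:
  assumes "\<delta> > 0" "\<And>v. norm v < \<delta> \<Longrightarrow> (\<lambda>k. c k * v ^ k) sums f v" "(\<lambda>k. g k * c k * w ^ k) sums y"
  shows "coeff_transform g f w y"
  using assms unfolding coeff_transform_def by (intro exI[of _ \<delta>] exI[of _ c]) auto

lemma coeff_transform_unique:
  assumes "coeff_transform g f w y" "coeff_transform g f' w y'"
    and "eventually (\<lambda>v. f v = f' v) (nhds 0)"
  shows "y = y'"
proof -
  obtain \<delta> c where c: "\<delta> > 0" "\<And>v. norm v < \<delta> \<Longrightarrow> (\<lambda>k. c k * v ^ k) sums f v"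
      "(\<lambda>k. g k * c k * w ^ k) sums y"
    using assms(1) by (auto simp: coeff_transform_def)
  obtain \<delta>' c' where c': "\<delta>' > 0" "\<And>v. norm v < \<delta>' \<Longrightarrow> (\<lambda>k. c' k * v ^ k) sums f' v"
      "(\<lambda>k. g k * c' k * w ^ k) sums y'"
    using assms(2) by (auto simp: coeff_transform_def)
  have "c = c'" by (rule power_series_coeffs_unique[OF c(1,2) c'(1,2) assms(3)])
  then show ?thesis using c(3) c'(3) sums_unique2 by blast
qed

lemma coeff_transform_add:
  assumes "coeff_transform g f w y" "coeff_transform g f' w y'"
  shows "coeff_transform g (\<lambda>v. f v + f' v) w (y + y')"
proof -
  obtain \<delta> c where c: "\<delta> > 0" "\<And>v. norm v < \<delta> \<Longrightarrow> (\<lambda>k. c k * v ^ k) sums f v"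
      "(\<lambda>k. g k * c k * w ^ k) sums y"
    using assms(1) by (auto simp: coeff_transform_def)
  obtain \<delta>' c' where c': "\<delta>' > 0" "\<And>v. norm v < \<delta>' \<Longrightarrow> (\<lambda>k. c' k * v ^ k) sums f' v"
      "(\<lambda>k. g k * c' k * w ^ k) sums y'"
    using assms(2) by (auto simp: coeff_transform_def)
  have "(\<lambda>k. (c k + c' k) * v ^ k) sums (f v + f' v)" if "norm v < min \<delta> \<delta>'" for v
    using sums_add[OF c(2)[of v] c'(2)[of v]] that by (simp add: algebra_simps)
  moreover have "(\<lambda>k. g k * (c k + c' k) * w ^ k) sums (y + y')"
    using sums_add[OF c(3) c'(3)] by (simp add: algebra_simps)
  ultimately show ?thesis
    using c(1) c'(1) by (intro coeff_transformI[of "min \<delta> \<delta>'"]) auto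
qed

lemma coeff_transform_cmult:
  assumes "coeff_transform g f w y"
  shows "coeff_transform g (\<lambda>v. a * f v) w (a * y)"
proof -
  obtain \<delta> c where c: "\<delta> > 0" "\<And>v. norm v < \<delta> \<Longrightarrow> (\<lambda>k. c k * v ^ k) sums f v"
      "(\<lambda>k. g k * c k * w ^ k) sums y"
    using assms(1) by (auto simp: coeff_transform_def)
  have "(\<lambda>k. a * c k * v ^ k) sums (a * f v)" if "norm v < \<delta>" for v
    using sums_mult[OF c(2)[OF that], of a] by (simp add: mult_ac)
  moreover have "(\<lambda>k. g k * (a * c k) * w ^ k) sums (a * y)"
    using sums_mult[OF c(3), of a] by (simp add: mult_ac)
  ultimately show ?thesis by (rule coeff_transformI[OF c(1)])
qed

text \<open>Fubini's theorem for double series with a product majorant. The sum over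
  \<open>k\<close> is read as an integral against counting measure, so that
  \<open>sums_integral\<close> performs the interchange.\<close>

lemma sums_swap_banach:
  fixes F :: "nat \<Rightarrow> nat \<Rightarrow> complex"
  assumes F: "\<And>n k. norm (F n k) \<le> M n * b k" and "summable M" "summable b" "\<And>n. 0 \<le> M n" "\<And>k. 0 \<le> b k"
  shows "summable (\<lambda>k. \<Sum>n. F n k)" "(\<lambda>n. \<Sum>k. F n k) sums (\<Sum>k. \<Sum>n. F n k)"
proof -
  have k: "summable (\<lambda>k. norm (F n k))" for n
    by (rule summable_comparison_test'[OF summable_mult[OF assms(3), of "M n"]]) (use F in auto)
  have n: "summable (\<lambda>n. norm (F n k))" for k
    by (rule summable_comparison_test'[OF summable_mult2[OF assms(2), of "b k"]]) (use F in auto)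
  have 1: "integrable (count_space UNIV) (F n)" for n
    using k by (simp add: integrable_count_space_nat_iff)
  have i: "integral\<^sup>L (count_space UNIV) (\<lambda>k. norm (F n k)) = (\<Sum>k. norm (F n k))" for n
    using 1 by (intro integral_count_space_nat) auto
  have 3: "summable (\<lambda>n. \<Sum>k. norm (F n k))"
  proof (rule summable_comparison_test'[OF summable_mult2[OF assms(2), of "suminf b"]])
    fix n
    have "(\<Sum>k. norm (F n k)) \<le> (\<Sum>k. M n * b k)"
      by (intro suminf_le F k summable_mult assms)
    also have "\<dots> = M n * suminf b" by (rule suminf_mult) fact
    finally show "norm (\<Sum>k. norm (F n k)) \<le> M n * suminf b"
      using suminf_nonneg[OF k, of n] by simp
  qed
  have int: "integrable (count_space UNIV) (\<lambda>k. \<Sum>n. F n k)"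
    by (rule integrable_suminf) (use 1 n 3 i in auto)
  then show "summable (\<lambda>k. \<Sum>n. F n k)"
    by (auto simp: integrable_count_space_nat_iff intro: summable_norm_cancel)
  have "(\<lambda>n. integral\<^sup>L (count_space UNIV) (F n)) sums integral\<^sup>L (count_space UNIV) (\<lambda>k. \<Sum>n. F n k)"
    by (rule sums_integral) (use 1 n 3 i in auto)
  then show "(\<lambda>n. \<Sum>k. F n k) sums (\<Sum>k. \<Sum>n. F n k)"
    using 1 int by (simp add: integral_count_space_nat)
qed

text \<open>Cauchy's estimate bounds the \<open>k\<close>-th coefficient of \<open>f n\<close> by
  \<open>M n\<close> over the \<open>k\<close>-th power of a fixed radius. The weights
  \<open>g\<close> beat every geometric growth, so the double series over \<open>n\<close> and
  \<open>k\<close> has a product majorant and may be summed in either order.\<close>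

lemma coeff_transform_suminf:
  assumes "\<delta> > 0" and holf: "\<And>n. f n holomorphic_on ball 0 \<delta>"
    and bnd: "\<And>n v. norm v < \<delta> \<Longrightarrow> norm (f n v) \<le> M n" and "summable M"
    and g: "\<And>R. summable (\<lambda>k. norm (g k) * R ^ k)"
    and ct: "\<And>n. coeff_transform g (f n) w (y n)"
  shows "summable y" "coeff_transform g (\<lambda>v. \<Sum>n. f n v) w (\<Sum>n. y n)"
proof -
  \<comment> \<open>Cauchy's inequality is applied on a closed disc inside the domain, hence a
    radius strictly below \<open>\<delta>\<close>.\<close>
  define \<epsilon> where "\<epsilon> = \<delta> / 2"
  have \<epsilon>: "0 < \<epsilon>" "\<epsilon> < \<delta>" using \<open>\<delta> > 0\<close> by (auto simp: \<epsilon>_def)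
  define c where "c n k = (deriv ^^ k) (f n) 0 / fact k" for n k
  have M: "0 \<le> M n" for n using bnd[of 0 n] \<open>\<delta> > 0\<close> norm_ge_zero[of "f n 0"] by (simp del: norm_ge_zero)
  have E: "(\<lambda>k. c n k * v ^ k) sums f n v" if "norm v < \<delta>" for n v
    using holomorphic_power_series[OF holf, of v n] that by (simp add: c_def)
  have B: "norm (c n k) \<le> M n * (1 / \<epsilon> ^ k)" for n k
  proof -
    have "norm ((deriv ^^ k) (f n) 0) \<le> fact k * M n / \<epsilon> ^ k"
      using \<epsilon> bnd by (intro Cauchy_inequality holomorphic_on_subset[OF holf]
          holomorphic_on_imp_continuous_on) auto
    then show ?thesis by (simp add: c_def norm_divide field_simps)
  qed
  \<comment> \<open>Uniqueness forces the coefficients hidden in the hypothesis \<open>ct\<close> to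
    be the Taylor coefficients \<open>c n\<close>.\<close>
  have y: "(\<lambda>k. g k * c n k * w ^ k) sums y n" for n
  proof -
    obtain \<delta>' c' where c': "\<delta>' > 0" "\<And>v. norm v < \<delta>' \<Longrightarrow> (\<lambda>k. c' k * v ^ k) sums f n v"
        "(\<lambda>k. g k * c' k * w ^ k) sums y n"
      using ct[of n] by (auto simp: coeff_transform_def)
    have "c n = c'" by (rule power_series_coeffs_unique[OF \<open>\<delta> > 0\<close> E c'(1,2)]) auto
    then show ?thesis using c' by simp
  qed
  define C where "C k = (\<Sum>n. c n k)" for k
  have sc: "summable (\<lambda>n. c n k)" for k
    by (rule summable_comparison_test'[OF summable_mult2[OF \<open>summable M\<close>, of "1 / \<epsilon> ^ k"]]) (use B in auto)
  \<comment> \<open>Used with two sequences: \<open>h k = v ^ k\<close> shows that the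
    coefficientwise sum \<open>C\<close> expands the sum of the functions, and
    \<open>h k = g k * w ^ k\<close> gives the transformed values.\<close>
  have sw: "(\<lambda>k. C k * h k) sums (\<Sum>k. C k * h k)" "(\<lambda>n. \<Sum>k. c n k * h k) sums (\<Sum>k. C k * h k)"
    if h: "summable (\<lambda>k. norm (h k) * (1 / \<epsilon>) ^ k)" for h
  proof -
    have "norm (c n k * h k) \<le> M n * (norm (h k) * (1 / \<epsilon>) ^ k)" for n k
      using mult_right_mono[OF B[of n k], of "norm (h k)"] by (simp add: norm_mult field_simps)
    note * = sums_swap_banach[OF this \<open>summable M\<close> h M]
    have "(\<Sum>n. c n k * h k) = C k * h k" for k
      unfolding C_def by (rule suminf_mult2[symmetric, OF sc])
    then show "(\<lambda>k. C k * h k) sums (\<Sum>k. C k * h k)" "(\<lambda>n. \<Sum>k. c n k * h k) sums (\<Sum>k. C k * h k)"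
      using * \<epsilon> by (auto simp: summable_sums)
  qed
  have C: "(\<lambda>k. C k * v ^ k) sums (\<Sum>n. f n v)" if "norm v < \<epsilon>" for v
  proof -
    have "summable (\<lambda>k. (norm v / \<epsilon>) ^ k)" using that \<epsilon> by (intro summable_geometric) auto
    then have "summable (\<lambda>k. norm (v ^ k) * (1 / \<epsilon>) ^ k)" by (simp add: norm_power power_divide)
    moreover have "(\<Sum>k. c n k * v ^ k) = f n v" for n
      using that \<epsilon> by (intro sums_unique[symmetric] E) auto
    ultimately show ?thesis using sw[of "\<lambda>k. v ^ k"] by (simp add: sums_iff)
  qed
  have "summable (\<lambda>k. norm (g k * w ^ k) * (1 / \<epsilon>) ^ k)"
    using g[of "norm w / \<epsilon>"] by (simp add: norm_mult norm_power power_divide)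
  note D = sw[OF this]
  have "(\<Sum>k. c n k * (g k * w ^ k)) = y n" for n
    using sums_unique[OF y[of n]] by (simp add: mult_ac)
  then have "y sums (\<Sum>k. C k * (g k * w ^ k))" using D by simp
  then have Y: "summable y" "(\<Sum>k. C k * (g k * w ^ k)) = (\<Sum>n. y n)" by (auto simp: sums_iff)
  show "summable y" by fact
  have "(\<lambda>k. g k * C k * w ^ k) sums (\<Sum>n. y n)"
    using D(1) by (simp add: Y mult_ac)
  with \<epsilon>(1) C show "coeff_transform g (\<lambda>v. \<Sum>n. f n v) w (\<Sum>n. y n)"
    by (rule coeff_transformI)
qed

section \<open>Transforms of the exponential kernels\<close>

text \<open>The entire function 0F1(;r;w) / Gamma(r). It is the branch-free factor of both J and I
  of order \<open>r - 1\<close>, taken at minus respectively plus the square of half their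
  argument.\<close>

definition bessel_series :: "real \<Rightarrow> complex \<Rightarrow> complex" where
  "bessel_series r w = (\<Sum>k. rGamma (of_real r + of_nat k) / fact k * w ^ k)"


lemma rGamma_weights_summable:
  fixes r R :: real
  assumes "r > 0"
  shows "summable (\<lambda>k. norm (rGamma (complex_of_real r + of_nat k)) * R ^ k)"
proof (cases "R = 0")
  case True
  then show ?thesis by (intro summable_finite[of "{0}"]) auto
next
  case False
  define f where "f k = norm (rGamma (complex_of_real r + of_nat k)) * R ^ k" for k
  have eq: "rGamma (complex_of_real r + of_nat k) = of_real (rGamma (r + k))" for k
    using rGamma_complex_of_real[of "r + k"] by simp
  have rec: "rGamma (r + k) = (r + k) * rGamma (r + Suc k)" for k
    using rGamma_plus1[of "r + k"] by (simp add: add_ac)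
  have nf: "norm (f k) = \<bar>rGamma (r + k)\<bar> * \<bar>R\<bar> ^ k" for k
    unfolding f_def eq norm_of_real by (simp add: abs_mult power_abs)
  \<comment> \<open>The recurrence divides the weight by \<open>r + n\<close>, which exceeds twice
    \<open>\<bar>R\<bar>\<close> from this index on.\<close>
  have "norm (f (Suc n)) \<le> 1 / 2 * norm (f n)" if "n \<ge> nat \<lceil>2 * \<bar>R\<bar>\<rceil>" for n
  proof -
    have n: "real n \<ge> 2 * \<bar>R\<bar>" using that by linarith
    have "norm (f n) = (r + n) * \<bar>rGamma (r + Suc n)\<bar> * \<bar>R\<bar> ^ n"
      using assms unfolding nf by (subst rec) (simp add: abs_mult)
    also have "\<dots> \<ge> (2 * \<bar>R\<bar>) * \<bar>rGamma (r + Suc n)\<bar> * \<bar>R\<bar> ^ n"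
      using n assms by (intro mult_right_mono) auto
    also have "(2 * \<bar>R\<bar>) * \<bar>rGamma (r + Suc n)\<bar> * \<bar>R\<bar> ^ n = 2 * norm (f (Suc n))"
      unfolding nf by (simp add: mult_ac)
    finally show ?thesis by simp
  qed
  then have "summable f" by (intro summable_ratio_test[of "1/2" "nat \<lceil>2 * \<bar>R\<bar>\<rceil>"]) auto
  then show ?thesis by (simp add: f_def[abs_def])
qed

lemma bessel_series_sums:
  assumes "r > 0"
  shows "(\<lambda>k. rGamma (of_real r + of_nat k) / fact k * w ^ k) sums bessel_series r w"
proof -
  have "summable (\<lambda>k. rGamma (of_real r + of_nat k) / fact k * w ^ k)"
  proof (rule summable_comparison_test'[OF rGamma_weights_summable[OF assms, of "norm w"]])
    fix k :: nat
    have "norm (rGamma (complex_of_real r + of_nat k)) * norm w ^ k / fact k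
        \<le> norm (rGamma (complex_of_real r + of_nat k)) * norm w ^ k / 1"
      by (intro divide_left_mono) (auto simp: fact_ge_1)
    then show "norm (rGamma (of_real r + of_nat k) / fact k * w ^ k)
        \<le> norm (rGamma (complex_of_real r + of_nat k)) * norm w ^ k"
      by (simp add: norm_mult norm_divide norm_power)
  qed
  then show ?thesis by (simp add: bessel_series_def summable_sums)
qed

abbreviation gamma_weight :: "real \<Rightarrow> nat \<Rightarrow> complex" where
  "gamma_weight r k \<equiv> rGamma (of_real r + of_nat k)"

lemma coeff_transform_exp:
  assumes "r > 0"
  shows "coeff_transform (gamma_weight r) (\<lambda>v. exp (- x * (1 + v))) w (exp (- x) * bessel_series r (- x * w))"
proof (rule coeff_transformI[of 1 "\<lambda>k. exp (- x) * ((- x) ^ k / fact k)"])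
  fix v :: complex
  have "(\<lambda>k. exp (- x) * ((- x * v) ^ k /\<^sub>R fact k)) sums (exp (- x) * exp (- x * v))"
    by (intro sums_mult exp_converges)
  also have "exp (- x) * exp (- x * v) = exp (- x * (1 + v))"
    by (simp add: exp_add[symmetric] algebra_simps)
  also have "(\<lambda>k. exp (- x) * ((- x * v) ^ k /\<^sub>R fact k)) = (\<lambda>k. exp (- x) * ((- x) ^ k / fact k) * v ^ k)"
    unfolding power_mult_distrib by (simp add: scaleR_conv_of_real field_simps)
  finally show "(\<lambda>k. exp (- x) * ((- x) ^ k / fact k) * v ^ k) sums exp (- x * (1 + v))" .
next
  show "(\<lambda>k. gamma_weight r k * (exp (- x) * ((- x) ^ k / fact k)) * w ^ k)
      sums (exp (- x) * bessel_series r (- x * w))"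
    using sums_mult[OF bessel_series_sums[OF assms, of "- x * w"], of "exp (- x)"]
    by (simp only: power_mult_distrib times_divide_eq_left times_divide_eq_right mult_ac)
qed simp

lemma coeff_transform_const:
  "coeff_transform g (\<lambda>_. a) w (g 0 * a)"
proof (rule coeff_transformI[of 1 "\<lambda>k. if k = 0 then a else 0"])
  show "(\<lambda>k. (if k = 0 then a else 0) * v ^ k) sums a" for v
    using sums_If_finite_set[of "{0}" "\<lambda>k. a * v ^ k"] by (simp add: if_distrib[of "\<lambda>x. x * _"] cong: if_cong)
  show "(\<lambda>k. g k * (if k = 0 then a else 0) * w ^ k) sums (g 0 * a)"
    using sums_If_finite_set[of "{0}" "\<lambda>k. g k * a * w ^ k"]
    by (simp add: if_distrib[of "\<lambda>x. x * _"] if_distrib[of "\<lambda>x. _ * x"] cong: if_cong)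
qed simp

text \<open>This cancellation dictates the choice of weights: the binomial coefficient is
  \<open>(- 1) ^ m / fact m\<close> times a Pochhammer symbol, and that symbol is the quotient of
  Gamma(r + i + m) by Gamma(r + i).\<close>

lemma gbinomial_gamma_weight:
  assumes "r > 0"
  shows "gamma_weight r (m + i) * ((- of_real r - of_nat i) gchoose m) = gamma_weight r i * (- 1) ^ m / fact m"
proof -
  have 1: "gamma_weight r (m + i) * pochhammer (of_real r + of_nat i) m = gamma_weight r i"
  proof -
    have "complex_of_real r + of_nat (m + i) = of_real r + of_nat i + of_nat m" by simp
    then show ?thesis
      using pochhammer_rGamma[of "complex_of_real r + of_nat i" m] by (simp only: mult_ac)
  qed
  have "((- of_real r - of_nat i) gchoose m) = (- 1) ^ m * pochhammer (complex_of_real r + of_nat i) m / fact m"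
    by (subst gbinomial_pochhammer) (simp add: add.commute)
  then show ?thesis unfolding 1[symmetric] by simp
qed

text \<open>The factor \<open>v ^ i\<close> shifts the binomial expansion by \<open>i\<close>
  places; after the cancellation above, the exponential series of \<open>- w\<close> remains. The
  case \<open>i = 0\<close> serves the residue term of the modular relation.\<close>

lemma coeff_transform_binomial:
  assumes "r > 0"
  shows "coeff_transform (gamma_weight r) (\<lambda>v. v ^ i * (1 + v) powr (- of_real r - of_nat i)) w
           (gamma_weight r i * w ^ i * exp (- w))"
proof (rule coeff_transformI[of 1 "\<lambda>k. if k < i then 0 else (- of_real r - of_nat i) gchoose (k - i)"])
  fix v :: complex assume v: "norm v < 1"
  let ?c = "\<lambda>k. if k < i then 0 else (- complex_of_real r - of_nat i) gchoose (k - i)"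
  show "(\<lambda>k. ?c k * v ^ k) sums (v ^ i * (1 + v) powr (- of_real r - of_nat i))"
    using sums_mult[OF gen_binomial_complex[OF v], of "v ^ i" "- of_real r - of_nat i"]
    by (subst sums_zero_iff_shift[of i, symmetric]) (auto simp: power_add mult_ac)
next
  let ?c = "\<lambda>k. if k < i then 0 else (- complex_of_real r - of_nat i) gchoose (k - i)"
  have "(\<lambda>m. gamma_weight r i * w ^ i * ((- w) ^ m /\<^sub>R fact m)) sums (gamma_weight r i * w ^ i * exp (- w))"
    by (intro sums_mult exp_converges)
  moreover have "gamma_weight r i * w ^ i * ((- w) ^ m /\<^sub>R fact m) = gamma_weight r (m + i) * ?c (m + i) * w ^ (m + i)" for m
    using gbinomial_gamma_weight[OF assms, of m i]
    by (simp add: scaleR_conv_of_real power_add field_simps power_minus[of w])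
  ultimately show "(\<lambda>k. gamma_weight r k * ?c k * w ^ k) sums (gamma_weight r i * w ^ i * exp (- w))"
    by (subst sums_zero_iff_shift[of i, symmetric]) auto
qed simp

text \<open>Both arguments are below pi/2 in absolute value, so their sum stays within the principal
  range.\<close>

lemma powr_mult_right_half_plane:
  assumes "Re z > 0" "Re w > 0"
  shows "(z * w) powr s = z powr s * w powr s"
proof -
  have "\<bar>Im (Ln z)\<bar> < pi/2" "\<bar>Im (Ln w)\<bar> < pi/2"
    using assms Re_Ln_pos_lt[of z] Re_Ln_pos_lt[of w] by (metis zero_complex.sel(1) less_irrefl)+
  then have "Ln (z * w) = Ln z + Ln w" using assms by (intro Ln_times_simple) auto
  then show ?thesis using assms by (auto simp: powr_def exp_add[symmetric] algebra_simps)
qed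

text \<open>Since 1 / (1 + v) = 1 - v / (1 + v), the exponential is exp(-x) times the exponential
  series in x v / (1 + v), and the terms of that series are the binomial functions just
  treated.\<close>

lemma coeff_transform_exp_inverse:
  assumes "r > 0"
  shows "coeff_transform (gamma_weight r) (\<lambda>v. (1 + v) powr (- of_real r) * exp (- x / (1 + v))) w
           (exp (- x) * exp (- w) * bessel_series r (x * w))"
proof -
  define f where "f i v = exp (- x) * x ^ i / fact i * (v ^ i * (1 + v) powr (- complex_of_real r - of_nat i))"
    for i v
  define M where "M i = exp (- Re x) * norm x ^ i / fact i * 2 powr r" for i
  define y where "y i = exp (- x) * x ^ i / fact i * (gamma_weight r i * w ^ i * exp (- w))" for i
  have pos: "Re (1 + v) > 1 / 2" "norm (1 + v) > 1 / 2" "norm v \<le> norm (1 + v)" if "norm v < 1 / 2" for v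
  proof -
    have "\<bar>Re v\<bar> < 1 / 2" using abs_Re_le_cmod[of v] that by linarith
    then show "Re (1 + v) > 1 / 2" by simp
    then show "norm (1 + v) > 1 / 2" using complex_Re_le_cmod[of "1 + v"] by linarith
    with that show "norm v \<le> norm (1 + v)" by simp
  qed
  have bnd: "norm (f i v) \<le> M i" if v: "norm v < 1 / 2" for i v
  proof -
    have 1: "norm ((1 + v) powr (- complex_of_real r - of_nat i)) = norm (1 + v) powr (- r - i)"
      using pos[OF v] by (subst norm_powr_real_powr') auto
    have "norm v / norm (1 + v) \<le> 1"
      using pos[OF v] by (subst divide_le_eq_1) auto
    note quot = this
    \<comment> \<open>For \<open>v\<close> of norm below 1/2 the quotient v / (1 + v) has norm at
      most 1, so only the power of \<open>norm (1 + v)\<close> with exponent \<open>- r\<close>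
      needs a bound, and that bound is uniform in \<open>i\<close>.\<close>
    have "norm v ^ i * norm (1 + v) powr (- r - i) = (norm v / norm (1 + v)) ^ i * norm (1 + v) powr (- r)"
    proof -
      have "norm (1 + v) > 0" using pos[OF v] by linarith
      then have "norm (1 + v) powr real i = norm (1 + v) ^ i" by (rule powr_realpow)
      then show ?thesis by (simp add: powr_diff power_divide)
    qed
    also have "\<dots> \<le> 1 ^ i * (1 / 2) powr (- r)"
      using pos[OF v] assms quot by (intro mult_mono power_mono powr_mono2') auto
    finally have "norm v ^ i * norm (1 + v) powr (- r - i) \<le> 2 powr r"
      by (simp add: powr_minus powr_divide)
    from mult_left_mono[OF this, of "exp (- Re x) * norm x ^ i / fact i"]
    show ?thesis by (simp add: f_def M_def norm_mult norm_divide norm_power 1)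
  qed
  have "summable M" unfolding M_def
    using summable_mult[OF summable_exp[of "norm x"], of "exp (- Re x)"]
    by (intro summable_mult2) (simp add: field_simps)
  have hol: "f i holomorphic_on ball 0 (1 / 2)" for i
    unfolding f_def using pos(1)
    by (intro holomorphic_intros) (force simp: complex_nonpos_Reals_iff)
  have ct: "coeff_transform (gamma_weight r) (f i) w (y i)" for i
    unfolding f_def y_def by (intro coeff_transform_cmult coeff_transform_binomial assms)
  have "coeff_transform (gamma_weight r) (\<lambda>v. \<Sum>i. f i v) w (\<Sum>i. y i)"
    by (rule coeff_transform_suminf[OF _ hol bnd \<open>summable M\<close> rGamma_weights_summable[OF assms] ct]) auto
  moreover have "(\<Sum>i. y i) = exp (- x) * exp (- w) * bessel_series r (x * w)"
    using sums_mult[OF bessel_series_sums[OF assms, of "x * w"], of "exp (- x) * exp (- w)"]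
    unfolding y_def by (intro sums_unique[symmetric]) (simp add: power_mult_distrib mult_ac)
  moreover have "(\<Sum>i. f i v) = (1 + v) powr (- of_real r) * exp (- x / (1 + v))" if v: "norm v < 1 / 2" for v
  proof -
    have nz: "1 + v \<noteq> 0" using pos(2)[OF v] by auto
    have "(\<lambda>i. exp (- x) * (1 + v) powr (- of_real r) * ((x * v / (1 + v)) ^ i /\<^sub>R fact i)) sums
        (exp (- x) * (1 + v) powr (- of_real r) * exp (x * v / (1 + v)))"
      by (intro sums_mult exp_converges)
    moreover have "exp (- x) * (1 + v) powr (- of_real r) * ((x * v / (1 + v)) ^ i /\<^sub>R fact i) = f i v" for i
      using nz by (simp add: f_def powr_diff powr_nat scaleR_conv_of_real power_divide power_mult_distrib field_simps)
    moreover have "exp (- x) * exp (x * v / (1 + v)) = exp (- x / (1 + v))"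
      using nz by (simp add: exp_add[symmetric] field_simps)
    ultimately show ?thesis by (simp add: sums_iff mult_ac)
  qed
  ultimately obtain \<delta> c where c: "\<delta> > 0" "\<And>v. norm v < \<delta> \<Longrightarrow> (\<lambda>k. c k * v ^ k) sums (\<Sum>i. f i v)"
      "(\<lambda>k. gamma_weight r k * c k * w ^ k) sums (exp (- x) * exp (- w) * bessel_series r (x * w))"
     and eq: "\<And>v. norm v < 1 / 2 \<Longrightarrow> (\<Sum>i. f i v) = (1 + v) powr (- of_real r) * exp (- x / (1 + v))"
    by (auto simp: coeff_transform_def)
  show ?thesis
  proof (rule coeff_transformI[OF _ _ c(3)])
    show "min \<delta> (1 / 2) > 0" using c by simp
    show "(\<lambda>k. c k * v ^ k) sums ((1 + v) powr (- of_real r) * exp (- x / (1 + v)))" if "norm v < min \<delta> (1 / 2)" for v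
      using c(2)[of v] eq[of v] that by simp
  qed
qed

section \<open>Mellin transforms in logarithmic coordinates\<close>

lemma cmod_of_real_powr: "x > 0 \<Longrightarrow> norm (complex_of_real x powr s) = x powr Re s"
  by (subst norm_powr_real_powr) (auto simp: powr_def)

text \<open>Euler's integral after the substitution t = exp u. The factor \<open>l\<close> is then
  absorbed by translating u by ln l, which preserves Lebesgue measure.\<close>

lemma exp_u_has_integral_Gamma:
  fixes s :: complex
  assumes "Re s > 0" "l > 0"
  shows "has_bochner_integral lborel (\<lambda>u. exp (s * of_real u) * exp (- of_real (l * exp u)))
           (Gamma s * of_real l powr (- s))"
proof -
  define F where "F u = exp (s * of_real u) * exp (- of_real (exp u))" for u :: real
  define f where "f t = complex_of_real t powr (s - 1) / of_real (exp t)" for t :: real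
  have "range (exp :: real \<Rightarrow> real) = {0<..}"
    using exp_ln rangeI[of "exp :: real \<Rightarrow> real"] by (auto, metis)
  moreover have "f absolutely_integrable_on {0<..}" "integral {0<..} f = Gamma s"
    using absolutely_integrable_Gamma_integral'[OF assms(1)] Gamma_integral_complex'[OF assms(1)]
    by (auto simp: f_def[abs_def] integral_unique)
  ultimately have "(\<lambda>u. \<bar>exp u\<bar> *\<^sub>R f (exp u)) absolutely_integrable_on UNIV \<and>
      integral UNIV (\<lambda>u. \<bar>exp u\<bar> *\<^sub>R f (exp u)) = Gamma s"
    by (subst has_absolute_integral_change_of_variables_real) (auto intro!: derivative_eq_intros simp: inj_on_def)
  moreover have "(\<lambda>u. \<bar>exp u\<bar> *\<^sub>R f (exp u)) = F"
    by (auto simp: fun_eq_iff F_def f_def scaleR_conv_of_real powr_def exp_of_real[symmetric] Ln_of_real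
        exp_minus exp_diff field_simps exp_add[symmetric])
  ultimately have F: "F absolutely_integrable_on UNIV" "integral UNIV F = Gamma s" by auto
  have "F \<in> borel_measurable lborel" unfolding F_def by measurable
  with F(1) have int: "integrable lborel F"
    by (simp add: set_integrable_def integrable_completion)
  then have I: "integral\<^sup>L lborel F = Gamma s"
    using has_integral_integral_lborel[OF int] F(2) integral_unique by metis
  have G: "has_bochner_integral lborel (\<lambda>u. of_real l powr (- s) * F (ln l + 1 * u)) (of_real l powr (- s) * Gamma s)"
    using lborel_integral_real_affine[of 1 F "ln l"] lborel_integrable_real_affine[OF int, of 1 "ln l"]
    by (intro has_bochner_integral_mult_right) (auto simp: has_bochner_integral_iff I)
  have "of_real l powr (- s) * F (ln l + 1 * u) = exp (s * of_real u) * exp (- of_real (l * exp u))" for u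
    using assms(2)
    by (simp add: F_def powr_def Ln_of_real exp_add ring_distribs exp_minus mult_ac flip: exp_of_real)
  with G show ?thesis by (simp add: mult_ac)
qed

text \<open>Power growth loses against exponential decay:
  \<open>lam n powr \<sigma> * exp (- x * lam n)\<close> falls below 1 once \<open>lam n\<close> is
  large.\<close>

lemma summable_exp_minus_lam:
  fixes c lam :: "nat \<Rightarrow> real"
  assumes "\<And>n. lam n > 0" "filterlim lam at_top sequentially" "summable (\<lambda>n. \<bar>c n\<bar> * lam n powr (- \<sigma>))" "x > 0"
  shows "summable (\<lambda>n. \<bar>c n\<bar> * exp (- x * lam n))"
proof (rule summable_comparison_test_ev[OF _ assms(3)])
  have "((\<lambda>t::real. t powr \<sigma> * exp (- x * t)) \<longlongrightarrow> 0) at_top"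
    using assms(4) by real_asymp
  then have "eventually (\<lambda>t::real. t powr \<sigma> * exp (- x * t) < 1) at_top"
    by (rule order_tendstoD) auto
  then have "eventually (\<lambda>n. lam n powr \<sigma> * exp (- x * lam n) < 1) sequentially"
    using assms(2) by (rule eventually_compose_filterlim)
  then show "eventually (\<lambda>n. norm (\<bar>c n\<bar> * exp (- x * lam n)) \<le> \<bar>c n\<bar> * lam n powr (- \<sigma>)) sequentially"
  proof eventually_elim
    case (elim n)
    then have "exp (- x * lam n) \<le> lam n powr (- \<sigma>)"
      using assms(1)[of n] by (simp add: powr_minus field_simps)
    then show ?case by (simp add: mult_left_mono abs_mult)
  qed
qed

lemma theta_mellin:
  fixes a :: "nat \<Rightarrow> complex" and lam :: "nat \<Rightarrow> real" and s :: complex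
  assumes pos: "\<And>n. lam n > 0" and "filterlim lam at_top sequentially"
    and sm: "summable (\<lambda>n. norm (a n) * lam n powr (- Re s))" and s: "Re s > 0"
  shows "has_bochner_integral lborel (\<lambda>u. exp (s * of_real u) * (\<Sum>n. a n * exp (- of_real (lam n * exp u))))
           (Gamma s * gen_dirichlet a lam s)"
proof -
  define f where "f n u = a n * (exp (s * of_real u) * exp (- of_real (lam n * exp u)))" for n and u :: real
  have 1: "has_bochner_integral lborel (f n) (a n * (Gamma s * of_real (lam n) powr (- s)))" for n
    unfolding f_def by (intro has_bochner_integral_mult_right exp_u_has_integral_Gamma s pos)
  have nf: "norm (f n u) = Re (of_real (norm (a n)) * (exp (of_real (Re s) * of_real u) * exp (- of_real (lam n * exp u))))" for n u
    unfolding f_def norm_mult norm_exp_eq_Re by (simp add: exp_of_real flip: of_real_mult of_real_minus)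
  \<comment> \<open>The norm is the same integrand with \<open>Re s\<close> for \<open>s\<close> and
    \<open>norm (a n)\<close> for \<open>a n\<close>. Hence the absolute integrals come from the
    same Gamma formula and have a finite sum, which justifies exchanging sum and integral.\<close>
  have 2: "has_bochner_integral lborel (\<lambda>u. norm (f n u)) (norm (a n) * (Gamma (Re s) * lam n powr (- Re s)))" for n
  proof -
    have "has_bochner_integral lborel
        (\<lambda>u. Re (of_real (norm (a n)) * (exp (of_real (Re s) * of_real u) * exp (- of_real (lam n * exp u)))))
        (Re (of_real (norm (a n)) * (Gamma (of_real (Re s)) * of_real (lam n) powr (- of_real (Re s)))))"
      using s pos by (intro has_bochner_integral_Re has_bochner_integral_mult_right exp_u_has_integral_Gamma) auto
    also have "Re (of_real (norm (a n)) * (Gamma (of_real (Re s)) * of_real (lam n) powr (- of_real (Re s))))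
        = norm (a n) * (Gamma (Re s) * lam n powr (- Re s))"
      using pos[of n] by (simp add: Gamma_complex_of_real powr_of_real flip: of_real_mult of_real_minus)
    finally show ?thesis by (simp add: nf)
  qed
  have 3: "summable (\<lambda>n. norm (a n) * exp (- exp u * lam n))" for u
    using summable_exp_minus_lam[of lam "\<lambda>n. norm (a n)" "Re s" "exp u"] assms by simp
  have 4: "summable (\<lambda>n. norm (f n u))" for u
    using summable_mult[OF 3[of u], of "exp (Re s * u)"]
    by (simp add: f_def norm_mult mult_ac)
  have 5: "summable (\<lambda>n. integral\<^sup>L lborel (\<lambda>u. norm (f n u)))"
    using summable_mult[OF sm, of "Gamma (Re s)"] 2 by (simp add: has_bochner_integral_iff mult_ac)
  have sums: "(\<lambda>n. integral\<^sup>L lborel (f n)) sums integral\<^sup>L lborel (\<lambda>u. \<Sum>n. f n u)"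
    and int: "integrable lborel (\<lambda>u. \<Sum>n. f n u)"
    using sums_integral[of lborel f] integrable_suminf[of lborel f] 1 4 5 by (auto simp: has_bochner_integral_iff)
  have "integral\<^sup>L lborel (\<lambda>u. \<Sum>n. f n u) = (\<Sum>n. Gamma s * (a n * of_real (lam n) powr (- s)))"
    using sums 1 by (simp add: sums_iff has_bochner_integral_iff mult_ac)
  also have "\<dots> = Gamma s * gen_dirichlet a lam s"
  proof -
    have "summable (\<lambda>n. a n * of_real (lam n) powr (- s))"
      by (rule summable_norm_cancel) (use sm pos in \<open>simp add: norm_mult cmod_of_real_powr\<close>)
    then show ?thesis by (simp add: gen_dirichlet_def suminf_mult)
  qed
  also have "(\<lambda>u. \<Sum>n. f n u) = (\<lambda>u. exp (s * of_real u) * (\<Sum>n. a n * exp (- of_real (lam n * exp u))))"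
  proof
    fix u :: real
    have "summable (\<lambda>n. a n * exp (- of_real (lam n * exp u)))"
      by (rule summable_norm_cancel) (use 3[of u] in \<open>simp add: norm_mult mult_ac\<close>)
    then show "(\<Sum>n. f n u) = exp (s * of_real u) * (\<Sum>n. a n * exp (- of_real (lam n * exp u)))"
      unfolding f_def by (subst suminf_mult[symmetric]) (auto simp: mult_ac)
  qed
  finally show ?thesis using int \<open>(\<lambda>u. \<Sum>n. f n u) = _\<close> by (simp add: has_bochner_integral_iff)
qed

section \<open>Entire Laplace transforms and uniqueness in the moment problem\<close>

text \<open>Expanding \<open>exp (s * of_real u)\<close> in powers of \<open>s\<close> gives one
  power series about 0 that converges for every \<open>s\<close>. The hypothesis at
  \<open>norm s\<close> and at its negative supplies the integrable majorant
  \<open>E\<close>.\<close>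

lemma laplace_entire:
  fixes f :: "real \<Rightarrow> complex"
  assumes [measurable]: "f \<in> borel_measurable borel"
    and int: "\<And>\<tau>::real. integrable lborel (\<lambda>u. exp (\<tau> * u) * norm (f u))"
  shows "(\<lambda>s. LBINT u. exp (s * of_real u) * f u) holomorphic_on UNIV"
proof -
  define c where "c k = (LBINT u. of_real u ^ k / fact k * f u)" for k
  have "(\<lambda>k. c k * s ^ k) sums (LBINT u. exp (s * of_real u) * f u)" for s
  proof -
    define F where "F k u = (s * of_real u) ^ k / fact k * f u" for k and u :: real
    have [measurable]: "F k \<in> borel_measurable borel" for k unfolding F_def by measurable
    define E where "E u = exp (norm s * u) * norm (f u) + exp (- norm s * u) * norm (f u)" for u
    have E: "integrable lborel E" unfolding E_def by (intro Bochner_Integration.integrable_add int)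
    have expE: "exp (norm s * \<bar>u\<bar>) * norm (f u) \<le> E u" for u
      unfolding E_def by (cases "u \<ge> 0") auto
    have nF: "norm (F k u) = (norm s * \<bar>u\<bar>) ^ k /\<^sub>R fact k * norm (f u)" for k u
      by (simp add: F_def norm_mult norm_divide norm_power field_simps power_mult_distrib)
    have sF: "(\<lambda>k. norm (F k u)) sums (exp (norm s * \<bar>u\<bar>) * norm (f u))" for u
      unfolding nF by (intro sums_mult2 exp_converges)
    have part: "(\<Sum>k<n. norm (F k u)) \<le> E u" for n u
      using sum_le_suminf[OF sums_summable[OF sF[of u]], of "{..<n}"] sums_unique[OF sF[of u]] expE[of u]
      by simp
    have iF: "integrable lborel (F k)" for k
    proof (rule Bochner_Integration.integrable_bound[OF E])
      show "AE u in lborel. norm (F k u) \<le> norm (E u)"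
      proof (rule AE_I2)
        fix u
        have "norm (F k u) \<le> (\<Sum>k<Suc k. norm (F k u))" by (simp add: sum_nonneg)
        also have "\<dots> \<le> E u" by (rule part)
        finally show "norm (F k u) \<le> norm (E u)" by simp
      qed
    qed simp
    have "summable (\<lambda>k. LBINT u. norm (F k u))"
    proof (rule summableI_nonneg_bounded)
      fix n
      have "(\<Sum>k<n. LBINT u. norm (F k u)) = (LBINT u. \<Sum>k<n. norm (F k u))"
        using iF by (intro Bochner_Integration.integral_sum[symmetric]) auto
      also have "\<dots> \<le> (LBINT u. E u)"
        using iF E part by (intro integral_mono) auto
      finally show "(\<Sum>k<n. LBINT u. norm (F k u)) \<le> (LBINT u. E u)" .
    qed auto
    then have "(\<lambda>k. LBINT u. F k u) sums (LBINT u. \<Sum>k. F k u)"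
      using iF sF by (intro sums_integral) (auto simp: sums_iff)
    also have "(\<lambda>u. \<Sum>k. F k u) = (\<lambda>u. exp (s * of_real u) * f u)"
    proof
      fix u
      have "(\<lambda>k. (s * of_real u) ^ k /\<^sub>R fact k * f u) sums (exp (s * of_real u) * f u)"
        by (intro sums_mult2 exp_converges)
      then show "(\<Sum>k. F k u) = exp (s * of_real u) * f u"
        by (simp add: F_def sums_iff scaleR_conv_of_real field_simps)
    qed
    also have "(\<lambda>k. LBINT u. F k u) = (\<lambda>k. c k * s ^ k)"
    proof
      fix k
      have "(LBINT u. F k u) = (LBINT u. (of_real u ^ k / fact k * f u) * s ^ k)"
        by (simp add: F_def power_mult_distrib mult_ac)
      then show "(LBINT u. F k u) = c k * s ^ k" by (simp add: c_def)
    qed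
    finally show ?thesis .
  qed
  then have hol: "(\<lambda>s. LBINT u. exp (s * of_real u) * f u) holomorphic_on ball 0 R" for R
    by (intro power_series_holomorphic[of _ _ c]) auto
  show ?thesis
    unfolding holomorphic_on_def
  proof
    fix s :: complex
    show "(\<lambda>s. LBINT u. exp (s * of_real u) * f u) field_differentiable at s within UNIV"
      by (rule holomorphic_on_imp_differentiable_at[OF hol[of "norm s + 1"] open_ball]) simp
  qed
qed

text \<open>With x = exp u, vanishing moments annihilate polynomials in x and hence, by uniform
  approximation on [0,1], continuous functions. The test function chosen makes the product with
  \<open>p\<close> nonnegative, so \<open>p\<close> vanishes almost everywhere on the half-line, and
  by continuity everywhere.\<close>

lemma zero_if_moments_zero:
  fixes p :: "real \<Rightarrow> real"
  assumes cont: "continuous_on UNIV p"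
    and int: "integrable lborel (\<lambda>u. indicator {..<0} u * p u)"
    and mom: "\<And>k::nat. (LBINT u. indicator {..<0} u * p u * exp u ^ k) = 0"
    and "u < 0"
  shows "p u = 0"
proof (rule ccontr)
  assume nz: "p u \<noteq> 0"
  \<comment> \<open>The factors \<open>x\<close> and \<open>1 / (1 + \<bar>p\<bar>)\<close> make the test function continuous at 0, whatever
    the behaviour of \<open>p\<close> at \<open>-\<infinity>\<close>.\<close>
  define \<psi> where "\<psi> x = (if x > 0 then x * (p (ln x) / (1 + \<bar>p (ln x)\<bar>)) else 0)" for x :: real
  define P where "P u = indicator {..<0} u * p u" for u
  have [measurable]: "p \<in> borel_measurable borel"
    using cont by (rule borel_measurable_continuous_onI)
  have [measurable]: "P \<in> borel_measurable borel" "\<psi> \<in> borel_measurable borel"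
    unfolding P_def \<psi>_def by measurable
  have fr: "\<bar>p t / (1 + \<bar>p t\<bar>)\<bar> \<le> 1" for t
  proof -
    have "1 + \<bar>p t\<bar> > 0" by linarith
    then show ?thesis by (simp add: abs_divide)
  qed
  have psi_le: "\<bar>\<psi> x\<bar> \<le> \<bar>x\<bar>" for x
    using mult_left_mono[OF fr[of "ln x"], of "\<bar>x\<bar>"] by (auto simp: \<psi>_def abs_mult)
  have "isCont \<psi> x" for x
  proof -
    consider "x > 0" | "x < 0" | "x = 0" by linarith
    then show ?thesis
    proof cases
      case 1
      have "isCont p t" for t using cont by (simp add: continuous_on_eq_continuous_at)
      then have "isCont (\<lambda>x. x * (p (ln x) / (1 + \<bar>p (ln x)\<bar>))) x"
        using 1 by (intro continuous_intros isCont_o2[of _ ln p]) auto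
      moreover have "eventually (\<lambda>y. y > 0) (nhds x)" using eventually_nhds_in_open[of "{0<..}" x] 1 by auto
      then have "eventually (\<lambda>y. \<psi> y = y * (p (ln y) / (1 + \<bar>p (ln y)\<bar>))) (nhds x)"
        by eventually_elim (simp add: \<psi>_def)
      ultimately show ?thesis by (simp add: isCont_cong)
    next
      case 2
      have "eventually (\<lambda>y. y < 0) (nhds x)" using eventually_nhds_in_open[of "{..<0}" x] 2 by auto
      then have "eventually (\<lambda>y. \<psi> y = 0) (nhds x)" by eventually_elim (simp add: \<psi>_def)
      then show ?thesis by (simp add: isCont_cong)
    next
      case 3
      have "(\<psi> \<longlongrightarrow> 0) (at 0)"
        by (rule Lim_null_comparison[of _ "\<lambda>x. \<bar>x\<bar>"])
           (use psi_le in \<open>auto intro!: tendsto_eq_intros\<close>)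
      then show ?thesis by (simp add: isCont_def 3 \<psi>_def)
    qed
  qed
  then have cpsi: "continuous_on {0..1} \<psi>" by (simp add: continuous_at_imp_continuous_on)
  have intP: "integrable lborel P" using int by (simp add: P_def[abs_def])
  have bd: "\<bar>P u * h (exp u)\<bar> \<le> \<bar>P u\<bar> * B" if "\<And>x. x \<in> {0..1} \<Longrightarrow> \<bar>h x\<bar> \<le> B" for u h B
    using that[of "exp u"] by (cases "u < 0") (auto simp: P_def abs_mult mult_left_mono)
  have intPk: "integrable lborel (\<lambda>u. P u * exp u ^ k)" for k
    by (rule Bochner_Integration.integrable_bound[OF intP])
       (use bd[of "\<lambda>x. x ^ k" 1] in \<open>auto simp: power_abs power_le_one\<close>)
  have psi1: "\<bar>\<psi> x\<bar> \<le> 1" if "x \<in> {0..1}" for x using psi_le[of x] that by auto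
  have intpsi: "integrable lborel (\<lambda>u. P u * \<psi> (exp u))"
    by (rule Bochner_Integration.integrable_bound[OF intP]) (use bd[of \<psi> 1] psi1 in auto)
  define N where "N = (LBINT u. \<bar>P u\<bar>)"
  have small: "\<bar>LBINT u. P u * \<psi> (exp u)\<bar> \<le> e * N" if "e > 0" for e
  proof -
    obtain q where q: "real_polynomial_function q" "\<And>x. x \<in> {0..1} \<Longrightarrow> \<bar>\<psi> x - q x\<bar> < e"
      using Stone_Weierstrass_real_polynomial_function[OF compact_Icc cpsi \<open>e > 0\<close>] by blast
    obtain a n where qs: "q = (\<lambda>x. \<Sum>i\<le>n. a i * x ^ i)"
      using q(1) unfolding real_polynomial_function_iff_sum by blast
    have Pq: "P u * q (exp u) = (\<Sum>i\<le>n. a i * (P u * exp u ^ i))" for u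
      by (simp add: qs sum_distrib_left mult_ac)
    have iq: "integrable lborel (\<lambda>u. P u * q (exp u))"
      unfolding Pq by (intro Bochner_Integration.integrable_sum integrable_mult_right intPk)
    have "(LBINT u. P u * q (exp u)) = 0"
      unfolding Pq using intPk mom by (simp add: P_def Bochner_Integration.integral_sum)
    then have "(LBINT u. P u * \<psi> (exp u)) = (LBINT u. P u * (\<psi> (exp u) - q (exp u)))"
      using intpsi iq by (simp add: right_diff_distrib)
    also have "\<bar>\<dots>\<bar> \<le> (LBINT u. \<bar>P u * (\<psi> (exp u) - q (exp u))\<bar>)"
      using integral_norm_bound[of lborel "\<lambda>u. P u * (\<psi> (exp u) - q (exp u))"] by simp
    also have "\<dots> \<le> (LBINT u. \<bar>P u\<bar> * e)"
      using intpsi iq intP bd[of "\<lambda>x. \<psi> x - q x" e] q(2)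
      by (intro integral_mono) (auto simp: right_diff_distrib less_imp_le)
    finally show ?thesis by (simp add: N_def mult.commute)
  qed
  have "(LBINT u. P u * \<psi> (exp u)) = 0"
  proof (rule ccontr)
    let ?I = "LBINT u. P u * \<psi> (exp u)"
    assume "?I \<noteq> 0"
    moreover have "N \<ge> 0" by (simp add: N_def)
    \<comment> \<open>The tolerance \<open>\<bar>?I\<bar> / (2 * (N + 1))\<close> would bound
      \<open>\<bar>?I\<bar>\<close> by less than half of itself; the \<open>+ 1\<close> covers
      \<open>N = 0\<close>.\<close>
    ultimately have "N * \<bar>?I\<bar> + 2 * \<bar>?I\<bar> \<le> 0" "0 \<le> N * \<bar>?I\<bar>"
      using small[of "\<bar>?I\<bar> / (2 * (N + 1))"] by (auto simp: field_simps)
    with \<open>?I \<noteq> 0\<close> show False by linarith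
  qed
  moreover have eqpsi: "P u * \<psi> (exp u) = indicator {..<0} u * (exp u * (p u * p u / (1 + \<bar>p u\<bar>)))" for u
    by (simp add: P_def \<psi>_def)
  moreover have "0 \<le> P u * \<psi> (exp u)" for u
    unfolding eqpsi by (intro mult_nonneg_nonneg divide_nonneg_nonneg zero_le_square) auto
  ultimately have "AE u in lborel. P u * \<psi> (exp u) = 0"
    using integral_nonneg_eq_0_iff_AE[OF intpsi] by simp
  moreover have "P u * \<psi> (exp u) = 0 \<longleftrightarrow> u \<notin> {u. u < 0 \<and> p u \<noteq> 0}" for u
  proof -
    have "1 + \<bar>p u\<bar> \<noteq> 0" by linarith
    then show ?thesis unfolding eqpsi by (auto simp: indicator_def)
  qed
  ultimately have AE: "AE u in lborel. u \<notin> {u. u < 0 \<and> p u \<noteq> 0}" by simp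
  \<comment> \<open>An open set of measure zero is empty, so the almost everywhere statement becomes
    a pointwise one.\<close>
  have op: "open {u. u < 0 \<and> p u \<noteq> 0}"
    using cont by (intro open_Collect_conj open_Collect_less open_Collect_neq continuous_intros)
  then have "{u. u < 0 \<and> p u \<noteq> 0} \<in> null_sets lborel"
    using AE by (subst AE_iff_null_sets) auto
  then have "negligible {u. u < 0 \<and> p u \<noteq> 0}"
    by (simp add: negligible_iff_null_sets null_sets_completionI)
  then show False using open_not_negligible[OF op] nz \<open>u < 0\<close> by auto
qed

section \<open>The polar part of the completed Dirichlet series\<close>

text \<open>At a regular point both the limit and the residue are 0. At a simple pole
  \<open>zor_poly\<close> extends the product continuously, and its value there is the residue. Thus
  both cases allowed at \<open>r\<close> are treated alike.\<close>

lemma analytic_times_tendsto_residue: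
  assumes "f analytic_on {z} \<or> is_pole f z \<and> zorder f z = -1" "isolated_singularity_at f z"
  shows "((\<lambda>s. (s - z) * f s) \<longlongrightarrow> residue f z) (at z)"
proof (cases "f analytic_on {z}")
  case True
  then have "isCont f z" by (simp add: analytic_at_imp_isCont)
  then have "((\<lambda>s. (s - z) * f s) \<longlongrightarrow> (z - z) * f z) (at z)"
    by (intro tendsto_intros) (simp add: isCont_def)
  moreover have "residue f z = 0"
    using True by (meson analytic_at residue_holo)
  ultimately show ?thesis by simp
next
  case False
  then have p: "is_pole f z" "zorder f z = -1" using assms(1) by auto
  have "residue f z = zor_poly f z z" by (rule residue_simple_pole) (use assms p in auto)
  obtain d where "d > 0" "f analytic_on ball z d - {z}"
    using assms(2) by (auto simp: isolated_singularity_at_def)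
  then have "f holomorphic_on ball z d - {z}" "z \<in> ball z d"
    by (auto intro: analytic_imp_holomorphic)
  then obtain e where e: "e > 0" "zor_poly f z holomorphic_on cball z e"
      "\<And>w. w \<in> cball z e - {z} \<Longrightarrow> f w = zor_poly f z w / (w - z)"
    using zorder_exist_pole[of f "ball z d" z] p by auto
  have "isCont (zor_poly f z) z"
    using e(1,2) by (intro continuous_on_interior[of "cball z e"] holomorphic_on_imp_continuous_on) auto
  then have "(zor_poly f z \<longlongrightarrow> zor_poly f z z) (at z)" by (simp add: isCont_def)
  moreover have "eventually (\<lambda>w. w \<in> cball z e - {z}) (at z)"
    using eventually_at_in_open[of "ball z e" z] e(1) by (auto elim!: eventually_mono)
  then have "eventually (\<lambda>w. zor_poly f z w = (w - z) * f w) (at z)"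
    by eventually_elim (use e(3) in auto)
  ultimately show ?thesis
    unfolding \<open>residue f z = zor_poly f z z\<close> by (blast intro: Lim_transform_eventually)
qed

text \<open>Gamma(s) \<Phi>(s) can be singular only at \<open>r\<close> and at nonpositive integers,
  its reflected counterpart only at 0 and at \<open>r\<close> plus natural numbers. As
  \<open>r > 0\<close>, the only common points are 0 and \<open>r\<close>; the singularities there
  are at most simple poles, and \<open>P\<close> is their polar part.\<close>

lemma hecke_entire_part:
  fixes r \<sigma>a \<sigma>b :: real
  assumes A: "class_A r a lam b mu \<Phi> \<Psi>"
    and \<sigma>a: "\<sigma>a > 0" "abs_abscissa a lam < ereal \<sigma>a" and \<sigma>b: "\<sigma>b > 0" "abs_abscissa b mu < ereal \<sigma>b"
  defines "P \<equiv> \<lambda>s. \<Phi> 0 / s + Gamma (of_real r) * residue \<Phi> (of_real r) / (s - of_real r)"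
  obtains E where "E holomorphic_on UNIV"
    "\<And>s. Re s \<ge> \<sigma>a \<Longrightarrow> Re s > r \<Longrightarrow> E s = Gamma s * gen_dirichlet a lam s - P s"
    "\<And>s. Re s < 0 \<Longrightarrow> Re s \<le> r - \<sigma>b \<Longrightarrow> E s = Gamma (of_real r - s) * gen_dirichlet b mu (of_real r - s) - P s"
    "\<And>\<sigma>1 \<sigma>2 \<epsilon>. \<epsilon> > 0 \<Longrightarrow> \<exists>T. \<forall>s. \<sigma>1 \<le> Re s \<longrightarrow> Re s \<le> \<sigma>2 \<longrightarrow> \<bar>Im s\<bar> \<ge> T \<longrightarrow> norm (E s + P s) < \<epsilon>"
proof -
  have r: "r > 0" and he: "hecke_equation r a lam b mu"
    and ea: "extends_with_simple_pole \<Phi> a lam r" and eb: "extends_with_simple_pole \<Psi> b mu r"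
    using A by (auto simp: class_A_def)
  obtain X K where X: "X meromorphic_on UNIV" "compact K" "X analytic_on (- K)"
    and Xa: "\<And>s. ereal (Re s) > abs_abscissa a lam \<Longrightarrow> s \<notin> \<int>\<^sub>\<le>\<^sub>0 \<Longrightarrow> X s = Gamma s * gen_dirichlet a lam s"
    and Xb: "\<And>s. ereal (Re s) < ereal r - abs_abscissa b mu \<Longrightarrow> of_real r - s \<notin> \<int>\<^sub>\<le>\<^sub>0 \<Longrightarrow>
        X s = Gamma (of_real r - s) * gen_dirichlet b mu (of_real r - s)"
    and Xs: "\<And>\<sigma>1 \<sigma>2 \<epsilon>. \<epsilon> > 0 \<Longrightarrow> \<exists>T. \<forall>s. \<sigma>1 \<le> Re s \<longrightarrow> Re s \<le> \<sigma>2 \<longrightarrow> \<bar>Im s\<bar> \<ge> T \<longrightarrow> norm (X s) < \<epsilon>"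
    using he unfolding hecke_equation_def by (elim exE conjE) blast
  have \<Phi>an: "\<Phi> analytic_on (- {of_real r})" and \<Psi>an: "\<Psi> analytic_on (- {of_real r})"
    and \<Phi>eq: "\<And>s. Re s \<ge> \<sigma>a \<Longrightarrow> \<Phi> s = gen_dirichlet a lam s"
    and \<Psi>eq: "\<And>s. Re s \<ge> \<sigma>b \<Longrightarrow> \<Psi> s = gen_dirichlet b mu s"
    using ea eb less_le_trans[OF \<sigma>a(2)] less_le_trans[OF \<sigma>b(2)] unfolding extends_with_simple_pole_def
    by simp_all
  have \<Phi>hol: "\<Phi> holomorphic_on (- {of_real r})" and \<Psi>hol: "\<Psi> holomorphic_on (- {of_real r})"
    using \<Phi>an \<Psi>an by (auto intro: analytic_imp_holomorphic)
  \<comment> \<open>\<open>D\<close> collects the points where one of the two products may be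
    singular, \<open>pts\<close> those where \<open>X\<close> is. Both sets are countable, so
    removing them leaves a connected set on which the identity theorem applies.\<close>
  define D where "D = {s. s \<in> \<int>\<^sub>\<le>\<^sub>0 \<or> of_real r - s \<in> \<int>\<^sub>\<le>\<^sub>0} \<union> {0, complex_of_real r}"
  define pts where "pts = {w. \<not> X analytic_on {w}}"
  define G1 where "G1 s = Gamma s * \<Phi> s" for s
  define G2 where "G2 s = Gamma (of_real r - s) * \<Psi> (of_real r - s)" for s
  have npos: "Re s \<le> 0" "Im s = 0" if "s \<in> \<int>\<^sub>\<le>\<^sub>0" for s :: complex
    using that by (auto elim!: nonpos_Ints_cases)
  have cd: "closed D"
  proof -
    have "D = \<int>\<^sub>\<le>\<^sub>0 \<union> (\<lambda>s. of_real r - s) -` \<int>\<^sub>\<le>\<^sub>0 \<union> {0, complex_of_real r}" by (auto simp: D_def)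
    moreover have "closed ((\<lambda>s. complex_of_real r - s) -` \<int>\<^sub>\<le>\<^sub>0)"
      by (intro closed_vimage continuous_intros) auto
    ultimately show ?thesis by (auto intro!: closed_Un closed_insert)
  qed
  have ctZ: "countable (\<int>\<^sub>\<le>\<^sub>0 :: complex set)"
    by (rule countable_subset[of _ \<int>]) (auto simp: Ints_def elim!: nonpos_Ints_cases)
  have ctD: "countable D"
  proof -
    have "s \<in> (\<lambda>s. of_real r - s) ` \<int>\<^sub>\<le>\<^sub>0" if "of_real r - s \<in> \<int>\<^sub>\<le>\<^sub>0" for s :: complex
      using imageI[OF that, of "\<lambda>s. of_real r - s"] by simp
    then have "D \<subseteq> \<int>\<^sub>\<le>\<^sub>0 \<union> (\<lambda>s. of_real r - s) ` \<int>\<^sub>\<le>\<^sub>0 \<union> {0, complex_of_real r}"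
      unfolding D_def by blast
    moreover have "countable \<dots>" using ctZ by auto
    ultimately show ?thesis by (rule countable_subset)
  qed
  have ctp: "countable pts"
    using sparse_imp_countable[OF open_UNIV meromorphic_on_imp_sparse_singularities[OF X(1)]] by (simp add: pts_def)
  have op: "open (- pts)"
  proof -
    have "\<exists>T. open T \<and> w \<in> T \<and> T \<subseteq> - pts" if "w \<in> - pts" for w
    proof -
      from that obtain T where "open T" "w \<in> T" "X holomorphic_on T"
        by (auto simp: pts_def analytic_at)
      then show ?thesis by (intro exI[of _ T]) (auto simp: pts_def analytic_at)
    qed
    then show ?thesis by (intro Topological_Spaces.openI)
  qed
  have conn: "connected (- T)" if "countable T" for T :: "complex set"
    using connected_open_diff_countable[of "UNIV :: complex set" T] that connected_UNIV by (simp add: Compl_eq_Diff_UNIV)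
  \<comment> \<open>Discs are uncountable, so every half-plane still contains points outside the
    exceptional sets.\<close>
  have ne: "U - T \<noteq> {}" if ct: "countable T" and U: "open U" "U \<noteq> {}" for T U :: "complex set"
  proof -
    obtain x e where "x \<in> U" "e > 0" "ball x e \<subseteq> U" using U open_contains_ball by blast
    then show ?thesis using uncountable_ball[of e x] countable_subset[OF _ ct, of "ball x e"] by blast
  qed
  have hol1: "G1 holomorphic_on - (\<int>\<^sub>\<le>\<^sub>0 \<union> {of_real r})"
    unfolding G1_def by (intro holomorphic_intros holomorphic_on_subset[OF \<Phi>hol]) auto
  have hol2: "G2 holomorphic_on - {s. of_real r - s \<in> \<int>\<^sub>\<le>\<^sub>0 \<or> s = 0}"
  proof -
    have "(\<Psi> \<circ> (\<lambda>s. of_real r - s)) holomorphic_on - {s. of_real r - s \<in> \<int>\<^sub>\<le>\<^sub>0 \<or> s = 0}"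
      by (intro holomorphic_on_compose_gen[OF _ \<Psi>hol] holomorphic_intros) auto
    then show ?thesis unfolding G2_def o_def by (intro holomorphic_intros) auto
  qed
  have G1D: "G1 holomorphic_on - D" and G2D: "G2 holomorphic_on - D"
    using hol1 hol2 by (auto intro: holomorphic_on_subset simp: D_def)
  define S where "S = - (D \<union> pts)"
  have S: "open S" "connected S" "S \<subseteq> - D"
    using cd op conn[of "D \<union> pts"] ctD ctp by (auto simp: S_def open_Compl intro!: open_Int)
  have XS: "X holomorphic_on S"
    by (intro analytic_imp_holomorphic) (subst analytic_on_analytic_at, auto simp: S_def pts_def)
  have X1: "X s = G1 s" if "s \<in> S" for s
  proof (rule analytic_continuation_open[of "{s. Re s > \<sigma>a} \<inter> S" S X G1])
    show "open ({s. Re s > \<sigma>a} \<inter> S)" using S by (intro open_Int open_halfspace_Re_gt)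
    have "{s. Re s > \<sigma>a} \<noteq> {}" by (auto intro: exI[of _ "of_real (\<sigma>a + 1)"])
    then show "{s. Re s > \<sigma>a} \<inter> S \<noteq> {}"
      using ne[of "D \<union> pts" "{s. Re s > \<sigma>a}"] ctD ctp open_halfspace_Re_gt by (auto simp: S_def)
    show "X z = G1 z" if "z \<in> {s. Re s > \<sigma>a} \<inter> S" for z
      using that less_trans[OF \<sigma>a(2), of "ereal (Re z)"] Xa[of z] \<Phi>eq[of z]
      by (auto simp: G1_def S_def D_def)
  qed (use S XS that G1D in \<open>auto intro: holomorphic_on_subset\<close>)
  have X2: "X s = G2 s" if "s \<in> S" for s
  proof (rule analytic_continuation_open[of "{s. Re s < r - \<sigma>b} \<inter> S" S X G2])
    show "open ({s. Re s < r - \<sigma>b} \<inter> S)" using S by (intro open_Int open_halfspace_Re_lt)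
    have "{s. Re s < r - \<sigma>b} \<noteq> {}" by (auto intro: exI[of _ "of_real (r - \<sigma>b - 1)"])
    then show "{s. Re s < r - \<sigma>b} \<inter> S \<noteq> {}"
      using ne[of "D \<union> pts" "{s. Re s < r - \<sigma>b}"] ctD ctp open_halfspace_Re_lt by (auto simp: S_def)
    show "X z = G2 z" if z: "z \<in> {s. Re s < r - \<sigma>b} \<inter> S" for z
    proof -
      have "ereal (Re z) < ereal r - ereal \<sigma>b" using z by simp
      also have "\<dots> \<le> ereal r - abs_abscissa b mu" using \<sigma>b by (intro ereal_minus_mono) auto
      finally show ?thesis using Xb[of z] z \<Psi>eq[of "of_real r - z"] by (auto simp: G2_def S_def D_def)
    qed
  qed (use S XS that G2D in \<open>auto intro: holomorphic_on_subset\<close>)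
  \<comment> \<open>\<open>X\<close> is the bridge between the two products. The equality extends to
    the points of \<open>pts\<close> outside \<open>D\<close>, where \<open>X\<close> is not
    analytic and its value may be arbitrary.\<close>
  have G12: "G1 s = G2 s" if "s \<notin> D" for s
  proof (rule analytic_continuation_open[of S "- D" G1 G2])
    show "S \<noteq> {}" using ne[of "D \<union> pts" UNIV] ctD ctp by (auto simp: S_def)
  qed (use S cd conn[OF ctD] G1D G2D X1 X2 that in \<open>auto\<close>)
  \<comment> \<open>The negative integers are not poles: there \<open>G2\<close> is regular, while \<open>G1\<close> has the junk value 0
    of \<open>Gamma\<close> at its poles.\<close>
  define Xh where "Xh s = (if s \<in> \<int>\<^sub>\<le>\<^sub>0 then G2 s else G1 s)" for s
  have Xh2: "Xh s = G2 s" if "Re s < 0" for s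
  proof (cases "s \<in> \<int>\<^sub>\<le>\<^sub>0")
    case False
    then have "s \<notin> D" using that r npos[of "of_real r - s"] by (auto simp: D_def)
    then show ?thesis using G12 False by (simp add: Xh_def)
  qed (simp add: Xh_def)
  have Xh: "Xh holomorphic_on - {0, of_real r}"
  proof -
    have "Xh holomorphic_on {s. Re s < 0} \<union> - (\<int>\<^sub>\<le>\<^sub>0 \<union> {of_real r})"
    proof (rule holomorphic_on_Un)
      show "Xh holomorphic_on {s. Re s < 0}"
      proof (rule holomorphic_transform[of G2])
        have "s \<in> - {s. of_real r - s \<in> \<int>\<^sub>\<le>\<^sub>0 \<or> s = 0}" if "Re s < 0" for s
          using that r npos(1)[of "of_real r - s"] by auto
        then show "G2 holomorphic_on {s. Re s < 0}"
          by (intro holomorphic_on_subset[OF hol2]) blast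
      qed (auto simp: Xh2)
      show "Xh holomorphic_on - (\<int>\<^sub>\<le>\<^sub>0 \<union> {of_real r})"
        by (rule holomorphic_transform[OF hol1]) (auto simp: Xh_def)
      show "open {s. Re s < 0}" by (rule open_halfspace_Re_lt)
      show "open (- (\<int>\<^sub>\<le>\<^sub>0 \<union> {complex_of_real r}))" by (intro open_Compl closed_Un) auto
    qed
    moreover have "Re s < 0" if "s \<in> \<int>\<^sub>\<le>\<^sub>0" "s \<noteq> 0" for s
      using npos[OF that(1)] that(2) by (cases "Re s = 0") (auto simp: complex_eq_iff)
    then have "- {0, of_real r} \<subseteq> {s. Re s < 0} \<union> - (\<int>\<^sub>\<le>\<^sub>0 \<union> {complex_of_real r})"
      by blast
    ultimately show ?thesis by (rule holomorphic_on_subset)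
  qed
  define Y where "Y s = Xh s - P s" for s
  have Yhol: "Y holomorphic_on - {0, of_real r}"
    unfolding Y_def P_def by (intro holomorphic_intros Xh) auto
  have r0: "complex_of_real r \<noteq> 0" using r by simp
  \<comment> \<open>Removability at 0: since s Gamma(s) = Gamma(s + 1) tends to 1, s times the glued
    function tends to \<Phi>(0), which the first term of \<open>P\<close> cancels.\<close>
  have "\<exists>g. g holomorphic_on - {of_real r} \<and> (\<forall>z\<in>- {of_real r} - {0}. g z = Y z)"
  proof (subst holomorphic_on_extend_lim)
    show "Y holomorphic_on - {of_real r} - {0}" by (rule holomorphic_on_subset[OF Yhol]) auto
    show "0 \<in> interior (- {complex_of_real r})" using r0 by (subst interior_open) auto
    have "isCont \<Phi> 0" using \<Phi>an r0 by (intro analytic_at_imp_isCont) (auto intro: analytic_on_subset)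
    moreover have "isCont (\<lambda>s. Gamma (s + 1 :: complex)) 0" by (intro isCont_Gamma continuous_intros) simp
    ultimately have "isCont (\<lambda>s. Gamma (s + 1) * \<Phi> s - \<Phi> 0
        - s * (Gamma (of_real r) * residue \<Phi> (of_real r) / (s - of_real r))) 0"
      using r0 by (intro continuous_intros) auto
    then have "((\<lambda>s. Gamma (s + 1) * \<Phi> s - \<Phi> 0
        - s * (Gamma (of_real r) * residue \<Phi> (of_real r) / (s - of_real r))) \<longlongrightarrow> 0) (at 0)"
      by (simp add: isCont_def)
    moreover have "eventually (\<lambda>s. s \<in> ball 0 1 - {0}) (at (0::complex))"
      by (rule eventually_at_in_open) auto
    then have "eventually (\<lambda>s. Gamma (s + 1) * \<Phi> s - \<Phi> 0
        - s * (Gamma (of_real r) * residue \<Phi> (of_real r) / (s - of_real r)) = (s - 0) * Y s) (at 0)"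
    proof eventually_elim
      case (elim s)
      have "s \<notin> \<int>\<^sub>\<le>\<^sub>0"
      proof
        assume "s \<in> \<int>\<^sub>\<le>\<^sub>0"
        then obtain n where "s = of_int n" by (auto elim!: nonpos_Ints_cases)
        then show False using elim by auto
      qed
      then show ?case using elim Gamma_plus1[of s]
        by (simp add: Y_def Xh_def G1_def P_def algebra_simps)
    qed
    ultimately show "((\<lambda>s. (s - 0) * Y s) \<longlongrightarrow> 0) (at 0)" by (rule Lim_transform_eventually)
  qed
  then obtain g where g: "g holomorphic_on - {of_real r}" "\<And>z. z \<noteq> of_real r \<Longrightarrow> z \<noteq> 0 \<Longrightarrow> g z = Y z" by auto
  \<comment> \<open>Removability at \<open>r\<close>: \<open>Gamma\<close> is continuous there and
    (s - r) \<Phi>(s) tends to the residue, which the second term of \<open>P\<close>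
    cancels.\<close>
  have "\<exists>E. E holomorphic_on UNIV \<and> (\<forall>z\<in>UNIV - {of_real r}. E z = g z)"
  proof (subst holomorphic_on_extend_lim)
    show "g holomorphic_on UNIV - {of_real r}" using g(1) by (simp add: Compl_eq_Diff_UNIV)
    have "isolated_singularity_at \<Phi> (of_real r)"
      using \<Phi>an unfolding isolated_singularity_at_def
      by (intro exI[of _ 1]) (auto intro: analytic_on_subset)
    then have "((\<lambda>s. (s - of_real r) * \<Phi> s) \<longlongrightarrow> residue \<Phi> (of_real r)) (at (of_real r))"
      using ea unfolding extends_with_simple_pole_def by (intro analytic_times_tendsto_residue) auto
    moreover have rZ: "of_real r \<notin> (\<int>\<^sub>\<le>\<^sub>0 :: complex set)" using r npos(1)[of "of_real r"] by auto
    then have "isCont Gamma (complex_of_real r)" by (intro continuous_intros)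
    then have "(Gamma \<longlongrightarrow> Gamma (of_real r)) (at (complex_of_real r))" by (simp add: isCont_def)
    ultimately have "((\<lambda>s. Gamma s * ((s - of_real r) * \<Phi> s) - (s - of_real r) * (\<Phi> 0 / s)
        - Gamma (of_real r) * residue \<Phi> (of_real r)) \<longlongrightarrow>
        Gamma (of_real r) * residue \<Phi> (of_real r) - (of_real r - of_real r) * (\<Phi> 0 / of_real r)
        - Gamma (of_real r) * residue \<Phi> (of_real r)) (at (of_real r))"
      using r0 rZ by (intro tendsto_intros)
    moreover have "eventually (\<lambda>s. s \<in> {s. Re s > 0} - {of_real r}) (at (complex_of_real r))"
      using r by (intro eventually_at_in_open open_halfspace_Re_gt) auto
    then have "eventually (\<lambda>s. Gamma s * ((s - of_real r) * \<Phi> s) - (s - of_real r) * (\<Phi> 0 / s)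
        - Gamma (of_real r) * residue \<Phi> (of_real r) = (s - of_real r) * g s) (at (complex_of_real r))"
    proof eventually_elim
      case (elim s)
      then have "s \<notin> \<int>\<^sub>\<le>\<^sub>0" "s \<noteq> 0" using npos(1)[of s] by auto
      then show ?case using elim by (simp add: g(2) Y_def Xh_def G1_def P_def field_simps)
    qed
    ultimately show "((\<lambda>s. (s - of_real r) * g s) \<longlongrightarrow> 0) (at (complex_of_real r))"
      by (auto intro: Lim_transform_eventually)
  qed auto
  then obtain E where E: "E holomorphic_on UNIV" "\<And>z. z \<noteq> of_real r \<Longrightarrow> E z = g z" by auto
  have EY: "E s = Xh s - P s" if "s \<noteq> 0" "s \<noteq> of_real r" for s
    using that E g by (simp add: Y_def)
  show ?thesis
  proof (rule that[OF E(1)])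
    fix s assume s: "Re s \<ge> \<sigma>a" "Re s > r"
    then have "s \<notin> \<int>\<^sub>\<le>\<^sub>0" "s \<noteq> 0" "s \<noteq> of_real r" using npos(1)[of s] r by auto
    then show "E s = Gamma s * gen_dirichlet a lam s - P s"
      using s \<Phi>eq by (simp add: EY Xh_def G1_def)
  next
    fix s assume s: "Re s < 0" "Re s \<le> r - \<sigma>b"
    then have "s \<noteq> 0" "s \<noteq> of_real r" using r by auto
    then show "E s = Gamma (of_real r - s) * gen_dirichlet b mu (of_real r - s) - P s"
      using s \<Psi>eq[of "of_real r - s"] by (simp add: EY Xh2 G2_def)
  next
    fix \<sigma>1 \<sigma>2 \<epsilon> :: real assume "\<epsilon> > 0"
    obtain T where T: "\<And>s. \<sigma>1 \<le> Re s \<Longrightarrow> Re s \<le> \<sigma>2 \<Longrightarrow> \<bar>Im s\<bar> \<ge> T \<Longrightarrow> norm (X s) < \<epsilon>"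
      using Xs[OF \<open>\<epsilon> > 0\<close>, of \<sigma>1 \<sigma>2] by blast
    obtain B where B: "\<And>s. s \<in> K \<Longrightarrow> norm s \<le> B"
      using compact_imp_bounded[OF X(2)] by (auto simp: bounded_iff)
    show "\<exists>T. \<forall>s. \<sigma>1 \<le> Re s \<longrightarrow> Re s \<le> \<sigma>2 \<longrightarrow> \<bar>Im s\<bar> \<ge> T \<longrightarrow> norm (E s + P s) < \<epsilon>"
    proof (intro exI[of _ "max T (\<bar>B\<bar> + 1)"] allI impI)
      fix s assume s: "\<sigma>1 \<le> Re s" "Re s \<le> \<sigma>2" "max T (\<bar>B\<bar> + 1) \<le> \<bar>Im s\<bar>"
      \<comment> \<open>Far from the real axis \<open>s\<close> avoids both \<open>K\<close> and the
        real set \<open>D\<close>, so it lies in \<open>S\<close>, where \<open>X\<close> equals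
        \<open>G1\<close>.\<close>
      have "s \<notin> K" using B[of s] s(3) abs_Im_le_cmod[of s] by auto
      then have "s \<notin> pts" using X(3) by (auto simp: pts_def intro: analytic_on_subset)
      moreover have "Im s \<noteq> 0" using s by auto
      then have "s \<notin> D" using npos(2)[of s] npos(2)[of "of_real r - s"] by (auto simp: D_def)
      ultimately have "s \<in> S" by (simp add: S_def)
      moreover have "s \<notin> \<int>\<^sub>\<le>\<^sub>0" "s \<noteq> 0" "s \<noteq> of_real r" using \<open>s \<notin> D\<close> by (auto simp: D_def)
      ultimately have "E s + P s = X s" using X1[of s] by (simp add: EY Xh_def)
      then show "norm (E s + P s) < \<epsilon>" using T[of s] s by auto
    qed
  qed
qed

section \<open>The modular relation\<close>

definition theta :: "(nat \<Rightarrow> complex) \<Rightarrow> (nat \<Rightarrow> real) \<Rightarrow> complex \<Rightarrow> complex" where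
  "theta a lam z = (\<Sum>n. a n * exp (- z * of_real (lam n)))"

lemma dirichlet_data_abscissa:
  assumes "dirichlet_data a lam"
  obtains \<sigma> where "\<sigma> > 0" "abs_abscissa a lam < ereal \<sigma>"
    "\<And>\<tau>. \<tau> \<ge> \<sigma> \<Longrightarrow> summable (\<lambda>n. norm (a n) * lam n powr (- \<tau>))"
proof -
  have pos: "\<And>n. lam n > 0" and lim: "filterlim lam at_top sequentially"
    and fin: "abs_abscissa a lam < \<infinity>"
    using assms by (auto simp: dirichlet_data_def)
  then obtain x where x: "summable (\<lambda>n. norm (a n * complex_of_real (lam n) powr (- of_real x)))"
    unfolding abs_abscissa_def Inf_less_iff by blast
  \<comment> \<open>This exceeds \<open>x\<close> strictly, hence also the abscissa. Being positive,
    it keeps the closed half-plane to its right away from the poles of \<open>Gamma\<close>.\<close>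
  define \<sigma> where "\<sigma> = max 1 (x + 1)"
  have "x < \<sigma>" by (simp add: \<sigma>_def)
  then have "ereal x < ereal \<sigma>" by simp
  moreover have "abs_abscissa a lam \<le> ereal x"
    unfolding abs_abscissa_def by (rule Inf_lower) (use x in auto)
  ultimately have 1: "abs_abscissa a lam < ereal \<sigma>" by order
  have x': "summable (\<lambda>n. norm (a n) * lam n powr (- x))"
    using x pos by (simp add: norm_mult cmod_of_real_powr)
  have "summable (\<lambda>n. norm (a n) * lam n powr (- \<tau>))" if "\<tau> \<ge> \<sigma>" for \<tau>
  proof (rule summable_comparison_test_ev[OF _ x'])
    have "eventually (\<lambda>n. lam n \<ge> 1) sequentially"
      using lim by (simp add: filterlim_at_top)
    then show "eventually (\<lambda>n. norm (norm (a n) * lam n powr (- \<tau>)) \<le> norm (a n) * lam n powr (- x)) sequentially"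
    proof eventually_elim
      case (elim n)
      then have "lam n powr (- \<tau>) \<le> lam n powr (- x)"
        using that by (intro powr_mono) (auto simp: \<sigma>_def)
      then show ?case by (simp add: mult_left_mono)
    qed
  qed
  with 1 show ?thesis using that[of \<sigma>] by (auto simp: \<sigma>_def)
qed

lemma summable_theta:
  assumes "dirichlet_data a lam" "x > 0"
  shows "summable (\<lambda>n. norm (a n) * exp (- x * lam n))"
proof -
  obtain \<sigma> where "summable (\<lambda>n. norm (a n) * lam n powr (- \<sigma>))"
    using dirichlet_data_abscissa[OF assms(1)] by (metis order_refl)
  then show ?thesis
    using summable_exp_minus_lam[of lam "\<lambda>n. norm (a n)" \<sigma> x] assms by (simp add: dirichlet_data_def)
qed

text \<open>Weierstrass's test on discs: for \<open>y\<close> within \<open>Re x / 2\<close> of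
  \<open>x\<close> the real part stays at least \<open>Re x / 2\<close>.\<close>

lemma theta_holomorphic:
  assumes "dirichlet_data a lam"
  shows "theta a lam holomorphic_on {z. Re z > 0}"
proof -
  let ?S = "{z. Re z > 0}"
  have "\<exists>d h. 0 < d \<and> summable h \<and> range h \<subseteq> \<real>\<^sub>\<ge>\<^sub>0 \<and>
      (\<forall>\<^sub>F n in sequentially. \<forall>y\<in>ball x d \<inter> ?S. cmod (a n * exp (- y * of_real (lam n))) \<le> cmod (h n))"
    if x: "x \<in> ?S" for x
  proof (intro exI conjI)
    show "0 < Re x / 2" using x by simp
    show "summable (\<lambda>n. complex_of_real (norm (a n) * exp (- (Re x / 2) * lam n)))"
      using summable_theta[OF assms, of "Re x / 2"] x
      by (intro summable_of_real) auto
    have "norm (a n * exp (- y * of_real (lam n))) \<le> norm (a n) * exp (- (Re x / 2) * lam n)"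
      if y: "y \<in> ball x (Re x / 2)" for y n
    proof -
      have "Re (x - y) \<le> norm (x - y)" by (rule complex_Re_le_cmod)
      also have "\<dots> < Re x / 2" using y by (simp add: dist_norm)
      finally have "Re x / 2 \<le> Re y" by simp
      moreover have "lam n > 0" using assms by (simp add: dirichlet_data_def)
      ultimately have "- Re y * lam n \<le> - (Re x / 2) * lam n" by simp
      then show ?thesis by (simp add: norm_mult mult_left_mono)
    qed
    then show "\<forall>\<^sub>F n in sequentially. \<forall>y\<in>ball x (Re x / 2) \<inter> ?S. cmod (a n * exp (- y * of_real (lam n)))
        \<le> cmod (complex_of_real (norm (a n) * exp (- (Re x / 2) * lam n)))"
      by (intro always_eventually) (auto simp: norm_mult)
  qed auto
  note bound = this
  have diff: "(\<lambda>x. a n * exp (- x * of_real (lam n))) field_differentiable at x" for n x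
    by (rule holomorphic_on_imp_differentiable_at[OF _ open_UNIV]) (auto intro!: holomorphic_intros)
  obtain g where g: "\<forall>x\<in>?S. (\<lambda>n. a n * exp (- x * of_real (lam n))) sums g x \<and> g field_differentiable (at x)"
    using series_differentiable_comparison_complex[OF open_halfspace_Re_gt diff bound] by blast
  then have "g holomorphic_on ?S" by (auto simp: holomorphic_on_def field_differentiable_at_within)
  then show ?thesis
    by (rule holomorphic_transform) (use g in \<open>auto simp: theta_def sums_iff\<close>)
qed

text \<open>The part over 0 < x < 1 of the Mellin integral of the theta series, in the coordinate x
  = exp u; \<open>theta_right\<close> is the part over x > 1.\<close>

definition theta_left :: "(nat \<Rightarrow> complex) \<Rightarrow> (nat \<Rightarrow> real) \<Rightarrow> complex \<Rightarrow> complex" where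
  "theta_left a lam s =
     (LBINT u. exp (s * of_real u) * (indicator {..<0} u * theta a lam (of_real (exp u))))"

definition theta_right :: "(nat \<Rightarrow> complex) \<Rightarrow> (nat \<Rightarrow> real) \<Rightarrow> complex \<Rightarrow> complex" where
  "theta_right a lam s =
     (LBINT u. exp (s * of_real u) * (indicator {0<..} u * theta a lam (of_real (exp u))))"

lemma continuous_theta_exp:
  assumes "dirichlet_data a lam"
  shows "continuous_on UNIV (\<lambda>u::real. theta a lam (of_real (exp u)))"
  using holomorphic_on_imp_continuous_on[OF theta_holomorphic[OF assms]]
  by (rule continuous_on_compose2) (auto intro!: continuous_intros)

text \<open>Integrability for all large real exponents settles both halves. For u < 0 the weight
  decreases in Re s, so the left part is bounded on a right half-plane; for u > 0 it increases, so
  the right part exists for every \<open>s\<close> and is bounded on each left half-plane. These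
  bounds feed Liouville's theorem.\<close>

lemma theta_parts:
  assumes "dirichlet_data a lam"
  obtains \<sigma> where "\<sigma> > 0" "abs_abscissa a lam < ereal \<sigma>"
    "\<And>s. Re s \<ge> \<sigma> \<Longrightarrow> integrable lborel
       (\<lambda>u. exp (s * of_real u) * (indicator {..<0} u * theta a lam (of_real (exp u))))"
    "\<And>s. integrable lborel
       (\<lambda>u. exp (s * of_real u) * (indicator {0<..} u * theta a lam (of_real (exp u))))"
    "\<And>s. Re s \<ge> \<sigma> \<Longrightarrow> Gamma s * gen_dirichlet a lam s = theta_left a lam s + theta_right a lam s"
    "theta_right a lam holomorphic_on UNIV"
    "\<And>\<tau>. \<exists>B. \<forall>s. Re s \<le> \<tau> \<longrightarrow> norm (theta_right a lam s) \<le> B"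
    "\<exists>B. \<forall>s. Re s \<ge> \<sigma> \<longrightarrow> norm (theta_left a lam s) \<le> B"
proof -
  obtain \<sigma> where \<sigma>: "\<sigma> > 0" "abs_abscissa a lam < ereal \<sigma>"
    "\<And>\<tau>. \<tau> \<ge> \<sigma> \<Longrightarrow> summable (\<lambda>n. norm (a n) * lam n powr (- \<tau>))"
    using dirichlet_data_abscissa[OF assms] by blast
  define \<theta> where "\<theta> u = theta a lam (of_real (exp u))" for u :: real
  have [measurable]: "\<theta> \<in> borel_measurable borel"
    using continuous_theta_exp[OF assms] by (intro borel_measurable_continuous_onI) (simp add: \<theta>_def[abs_def])
  have M: "has_bochner_integral lborel (\<lambda>u. exp (s * of_real u) * \<theta> u) (Gamma s * gen_dirichlet a lam s)"
    if "Re s \<ge> \<sigma>" for s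
    using theta_mellin[of lam a s] assms \<sigma>(1) \<sigma>(3)[OF that] that
    by (simp add: dirichlet_data_def \<theta>_def theta_def mult.commute)
  define N where "N \<tau> u = exp (\<tau> * u) * norm (\<theta> u)" for \<tau> u :: real
  have N: "integrable lborel (N \<tau>)" if "\<tau> \<ge> \<sigma>" for \<tau>
  proof -
    have "N \<tau> = (\<lambda>u. norm (exp (of_real \<tau> * of_real u) * \<theta> u))"
      by (simp add: N_def fun_eq_iff norm_mult flip: of_real_mult)
    then show ?thesis
      using M[of "of_real \<tau>"] that by (auto simp: has_bochner_integral_iff intro: integrable_norm)
  qed
  have NI: "integrable lborel (\<lambda>u. indicator S u * N \<tau> u)" if "\<tau> \<ge> \<sigma>" "S \<in> sets borel" for S \<tau>
    using integrable_mult_indicator[of S lborel "N \<tau>"] N[OF that(1)] that(2) by simp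
  have nL: "norm (exp (s * of_real u) * (indicator {..<0} u * \<theta> u)) \<le> indicator {..<0} u * N \<sigma> u"
    if "Re s \<ge> \<sigma>" for s u
    using that by (auto simp: N_def norm_mult indicator_def mult_right_mono)
  have nR: "norm (exp (s * of_real u) * (indicator {0<..} u * \<theta> u)) \<le> indicator {0<..} u * N \<tau> u"
    if "Re s \<le> \<tau>" for s u \<tau>
    using that by (auto simp: N_def norm_mult indicator_def mult_right_mono)
  have iL: "integrable lborel (\<lambda>u. exp (s * of_real u) * (indicator {..<0} u * \<theta> u))" if "Re s \<ge> \<sigma>" for s
    using nL[OF that] order_trans[OF _ abs_ge_self]
    by (intro Bochner_Integration.integrable_bound[OF NI[of \<sigma> "{..<0}"]]) (auto intro!: AE_I2)
  have iR: "integrable lborel (\<lambda>u. exp (s * of_real u) * (indicator {0<..} u * \<theta> u))" for s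
    using nR[of s "max \<sigma> (Re s)"] order_trans[OF _ abs_ge_self]
    by (intro Bochner_Integration.integrable_bound[OF NI[of "max \<sigma> (Re s)" "{0<..}"]]) (auto intro!: AE_I2)
  have split: "Gamma s * gen_dirichlet a lam s = theta_left a lam s + theta_right a lam s" if "Re s \<ge> \<sigma>" for s
  proof -
    have "Gamma s * gen_dirichlet a lam s = (LBINT u. exp (s * of_real u) * \<theta> u)"
      using M[OF that] by (simp add: has_bochner_integral_iff)
    also have "\<dots> = (LBINT u. exp (s * of_real u) * (indicator {..<0} u * \<theta> u) +
        exp (s * of_real u) * (indicator {0<..} u * \<theta> u))"
      using AE_lborel_singleton[of "0::real"]
      by (intro integral_cong_AE) (measurable, auto elim!: eventually_mono simp: indicator_def)
    also have "\<dots> = theta_left a lam s + theta_right a lam s"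
      unfolding theta_left_def theta_right_def using iL[OF that] iR[of s]
      by (subst Bochner_Integration.integral_add) (simp_all add: \<theta>_def)
    finally show ?thesis .
  qed
  have hol: "theta_right a lam holomorphic_on UNIV"
  proof -
    have "integrable lborel (\<lambda>u. exp (\<tau> * u) * norm (indicator {0<..} u * \<theta> u))" for \<tau>
      using integrable_norm[OF iR[of "of_real \<tau>"]] by (simp add: norm_mult)
    moreover have "(\<lambda>u. indicator {0<..} u * \<theta> u) \<in> borel_measurable borel" by measurable
    ultimately show ?thesis
      using laplace_entire[of "\<lambda>u. indicator {0<..} u * \<theta> u"] by (simp add: theta_right_def[abs_def] \<theta>_def)
  qed
  have bR: "\<exists>B. \<forall>s. Re s \<le> \<tau> \<longrightarrow> norm (theta_right a lam s) \<le> B" for \<tau>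
  proof (intro exI allI impI)
    fix s assume "Re s \<le> \<tau>"
    then have s: "Re s \<le> max \<sigma> \<tau>" by simp
    show "norm (theta_right a lam s) \<le> (LBINT u. indicator {0<..} u * N (max \<sigma> \<tau>) u)"
      unfolding theta_right_def using nR[OF s] iR NI[of "max \<sigma> \<tau>" "{0<..}"]
      by (intro Bochner_Integration.integral_norm_bound_integral) (auto simp: \<theta>_def)
  qed
  have bL: "\<exists>B. \<forall>s. Re s \<ge> \<sigma> \<longrightarrow> norm (theta_left a lam s) \<le> B"
  proof (intro exI allI impI)
    fix s assume s: "Re s \<ge> \<sigma>"
    show "norm (theta_left a lam s) \<le> (LBINT u. indicator {..<0} u * N \<sigma> u)"
      unfolding theta_left_def using nL[OF s] iL[OF s] NI[of \<sigma> "{..<0}"]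
      by (intro Bochner_Integration.integral_norm_bound_integral) (auto simp: \<theta>_def)
  qed
  show ?thesis using that[OF \<sigma>(1,2)] iL iR split hol bR bL by (simp add: \<theta>_def)
qed

section \<open>From Liouville's theorem to the relation between the theta series\<close>

lemma exp_integral_left:
  fixes c :: real
  assumes "c > 0"
  shows "has_bochner_integral lborel (\<lambda>u. indicator {..<0} u * exp (c * u)) (1 / c)"
proof -
  have hi: "((\<lambda>u::real. exp (- c * u)) has_integral 1 / c) {0..}"
    using has_integral_exp_minus_to_infinity[OF assms, of 0] by simp
  then have "(\<lambda>u::real. exp (- c * u)) absolutely_integrable_on {0..}"
    by (intro nonnegative_absolutely_integrable_1) (auto simp: integrable_on_def)
  then have si: "set_integrable lborel {0..} (\<lambda>u::real. exp (- c * u))"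
    unfolding set_integrable_def by (subst (asm) integrable_completion) auto
  then have "(LINT u:{0..}|lborel. exp (- c * u)) = 1 / c"
    using set_borel_integral_eq_integral(2)[OF si] hi by (simp add: integral_unique)
  with si have 1: "has_bochner_integral lborel (\<lambda>u. indicator {0..} u * exp (- c * u)) (1 / c)"
    by (simp add: set_integrable_def set_lebesgue_integral_def has_bochner_integral_iff)
  have "has_bochner_integral lborel (\<lambda>u. indicator {0..} (0 + (- 1) * u) * exp (- c * (0 + (- 1) * u))) (1 / c)"
    using 1 lborel_integral_real_affine[of "- 1" "\<lambda>u. indicator {0..} u * exp (- c * u)" 0]
      lborel_integrable_real_affine[of "\<lambda>u. indicator {0..} u * exp (- c * u)" "- 1" 0]
    by (simp add: has_bochner_integral_iff)
  then show ?thesis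
  proof (subst (asm) has_bochner_integral_cong_AE)
    show "AE u in lborel. indicator {0..} (0 + (- 1) * u) * exp (- c * (0 + (- 1) * u)) = indicator {..<0} u * exp (c * u)"
      using AE_lborel_singleton[of "0::real"] by (auto elim!: eventually_mono simp: indicator_def)
  qed auto
qed

text \<open>The moments need not vanish, only agree: consecutive differences then vanish, which
  inserts the factor 1 - exp u, nonzero for u < 0.\<close>

lemma zero_if_laplace_const:
  fixes h :: "real \<Rightarrow> complex" and K :: nat
  assumes cont: "continuous_on UNIV h"
    and int: "\<And>k. k \<ge> K \<Longrightarrow> has_bochner_integral lborel (\<lambda>u. indicator {..<0} u * h u * exp (of_nat k * of_real u)) \<kappa>"
    and "u < 0"
  shows "h u = 0"
proof -
  \<comment> \<open>The factor with \<open>K\<close> makes the known moments start at exponent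
    0.\<close>
  define q where "q u = h u * exp (of_nat K * of_real u) * (1 - exp (of_real u))" for u :: real
  have cq: "continuous_on UNIV q" unfolding q_def by (intro continuous_intros cont)
  have q: "has_bochner_integral lborel (\<lambda>u. indicator {..<0} u * q u * of_real (exp u ^ k)) 0" for k
  proof -
    have "has_bochner_integral lborel (\<lambda>u. indicator {..<0} u * h u * exp (of_nat (K + k) * of_real u)
        - indicator {..<0} u * h u * exp (of_nat (K + Suc k) * of_real u)) (\<kappa> - \<kappa>)"
      by (intro has_bochner_integral_diff int) auto
    moreover have "indicator {..<0} u * h u * exp (of_nat (K + k) * of_real u)
        - indicator {..<0} u * h u * exp (of_nat (K + Suc k) * of_real u) = indicator {..<0} u * q u * of_real (exp u ^ k)" for u
    proof -
      have "complex_of_real (exp u ^ k) = exp (of_nat k * of_real u)"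
        by (simp add: exp_of_nat_mult exp_of_real)
      moreover have "exp (of_nat (K + k) * complex_of_real u) = exp (of_nat K * of_real u) * exp (of_nat k * of_real u)"
        "exp (of_nat (K + Suc k) * complex_of_real u)
          = exp (of_nat K * of_real u) * exp (of_nat k * of_real u) * exp (of_real u)"
        by (simp_all add: distrib_right exp_add)
      ultimately show ?thesis unfolding q_def by (simp only: algebra_simps mult_1_right mult_1_left)
    qed
    ultimately show ?thesis by simp
  qed
  have "Re (q u) = 0"
  proof (rule zero_if_moments_zero[OF _ _ _ \<open>u < 0\<close>])
    show "continuous_on UNIV (\<lambda>u. Re (q u))" by (intro continuous_intros cq)
    have R: "has_bochner_integral lborel (\<lambda>u. indicator {..<0} u * Re (q u) * exp u ^ k) 0" for k
    proof -
      have "(\<lambda>u. indicator {..<0} u * Re (q u) * exp u ^ k) = (\<lambda>u. Re (indicator {..<0} u * q u * of_real (exp u ^ k)))"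
        by (auto simp: fun_eq_iff indicator_def simp flip: of_real_power)
      then show ?thesis using has_bochner_integral_Re[OF q[of k]] by simp
    qed
    show "integrable lborel (\<lambda>u. indicator {..<0} u * Re (q u))"
      using R[of 0] by (simp add: has_bochner_integral_iff)
    show "(LBINT u. indicator {..<0} u * Re (q u) * exp u ^ k) = 0" for k
      using R[of k] by (simp add: has_bochner_integral_iff)
  qed
  moreover have "Im (q u) = 0"
  proof (rule zero_if_moments_zero[OF _ _ _ \<open>u < 0\<close>])
    show "continuous_on UNIV (\<lambda>u. Im (q u))" by (intro continuous_intros cq)
    have R: "has_bochner_integral lborel (\<lambda>u. indicator {..<0} u * Im (q u) * exp u ^ k) 0" for k
    proof -
      have "(\<lambda>u. indicator {..<0} u * Im (q u) * exp u ^ k) = (\<lambda>u. Im (indicator {..<0} u * q u * of_real (exp u ^ k)))"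
        by (auto simp: fun_eq_iff indicator_def simp flip: of_real_power)
      then show ?thesis using has_bochner_integral_Im[OF q[of k]] by simp
    qed
    show "integrable lborel (\<lambda>u. indicator {..<0} u * Im (q u))"
      using R[of 0] by (simp add: has_bochner_integral_iff)
    show "(LBINT u. indicator {..<0} u * Im (q u) * exp u ^ k) = 0" for k
      using R[of k] by (simp add: has_bochner_integral_iff)
  qed
  ultimately have "q u = 0" by (simp add: complex_eq_iff)
  moreover have "exp (complex_of_real u) \<noteq> 1" using \<open>u < 0\<close> by (simp add: exp_of_real)
  ultimately show ?thesis by (simp add: q_def)
qed

text \<open>The moments in question are the values at large integers of one entire function
  \<open>H\<close>, which is bounded and hence constant.\<close>

lemma hecke_laplace_const:
  assumes A: "class_A r a lam b mu \<Phi> \<Psi>"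
  obtains \<kappa> K where "\<And>k. k \<ge> K \<Longrightarrow> has_bochner_integral lborel
    (\<lambda>u. indicator {..<0} u * (theta a lam (of_real (exp u)) - \<Phi> 0
       - Gamma (of_real r) * residue \<Phi> (of_real r) * of_real (exp (- r * u))
       - of_real (exp (- r * u)) * theta b mu (of_real (exp (- u)))) * exp (of_nat k * of_real u)) \<kappa>"
proof -
  have r: "r > 0" and da: "dirichlet_data a lam" and db: "dirichlet_data b mu"
    using A by (auto simp: class_A_def)
  define c0 where "c0 = \<Phi> 0"
  define c1 where "c1 = Gamma (of_real r) * residue \<Phi> (of_real r)"
  define P where "P s = c0 / s + c1 / (s - of_real r)" for s
  obtain \<sigma>a where a: "\<sigma>a > 0" "abs_abscissa a lam < ereal \<sigma>a"
    "\<And>s. Re s \<ge> \<sigma>a \<Longrightarrow> integrable lborel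
       (\<lambda>u. exp (s * of_real u) * (indicator {..<0} u * theta a lam (of_real (exp u))))"
    "\<And>s. Re s \<ge> \<sigma>a \<Longrightarrow> Gamma s * gen_dirichlet a lam s = theta_left a lam s + theta_right a lam s"
    "theta_right a lam holomorphic_on UNIV"
    "\<And>\<tau>. \<exists>B. \<forall>s. Re s \<le> \<tau> \<longrightarrow> norm (theta_right a lam s) \<le> B"
    "\<exists>B. \<forall>s. Re s \<ge> \<sigma>a \<longrightarrow> norm (theta_left a lam s) \<le> B"
    by (rule theta_parts[OF da]) (rule that; assumption)
  obtain \<sigma>b where b: "\<sigma>b > 0" "abs_abscissa b mu < ereal \<sigma>b"
    "\<And>s. integrable lborel
       (\<lambda>u. exp (s * of_real u) * (indicator {0<..} u * theta b mu (of_real (exp u))))"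
    "\<And>s. Re s \<ge> \<sigma>b \<Longrightarrow> Gamma s * gen_dirichlet b mu s = theta_left b mu s + theta_right b mu s"
    "theta_right b mu holomorphic_on UNIV"
    "\<And>\<tau>. \<exists>B. \<forall>s. Re s \<le> \<tau> \<longrightarrow> norm (theta_right b mu s) \<le> B"
    "\<exists>B. \<forall>s. Re s \<ge> \<sigma>b \<longrightarrow> norm (theta_left b mu s) \<le> B"
    by (rule theta_parts[OF db]) (rule that; assumption)
  obtain E where E: "E holomorphic_on UNIV"
    "\<And>s. Re s \<ge> \<sigma>a \<Longrightarrow> Re s > r \<Longrightarrow> E s = Gamma s * gen_dirichlet a lam s - P s"
    "\<And>s. Re s < 0 \<Longrightarrow> Re s \<le> r - \<sigma>b \<Longrightarrow> E s = Gamma (of_real r - s) * gen_dirichlet b mu (of_real r - s) - P s"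
    "\<And>\<sigma>1 \<sigma>2 \<epsilon>. \<epsilon> > 0 \<Longrightarrow> \<exists>T. \<forall>s. \<sigma>1 \<le> Re s \<longrightarrow> Re s \<le> \<sigma>2 \<longrightarrow> \<bar>Im s\<bar> \<ge> T \<longrightarrow> norm (E s + P s) < \<epsilon>"
    by (rule hecke_entire_part[OF A a(1,2) b(1,2), folded c0_def c1_def, folded P_def]) (rule that; assumption)
  \<comment> \<open>On the far right the left part of the first theta series survives in
    \<open>H\<close>, on the far left that of the second, each together with functions bounded
    there.\<close>
  define H where "H s = E s - theta_right a lam s - theta_right b mu (of_real r - s)" for s
  have "(theta_right b mu \<circ> (\<lambda>s. of_real r - s)) holomorphic_on UNIV"
    by (intro holomorphic_on_compose_gen[OF _ b(5)] holomorphic_intros) auto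
  then have Hhol: "H holomorphic_on UNIV"
    unfolding H_def o_def by (intro holomorphic_intros E(1) a(5))
  \<comment> \<open>Places both outer regions inside the half-planes where the Dirichlet series
    represent \<open>E + P\<close>, and at distance at least 1 from the poles 0 and \<open>r\<close>
    of \<open>P\<close>.\<close>
  define C where "C = max \<sigma>a \<sigma>b + r + 1"
  have C: "C \<ge> \<sigma>a" "C > r" "C \<ge> \<sigma>b" "C \<ge> r + 1" "C \<ge> 1" "C > 0" using r a(1) b(1) by (auto simp: C_def)
  obtain B1 where B1: "\<And>s. Re s \<le> C \<Longrightarrow> norm (theta_right a lam s) \<le> B1" using a(6) by blast
  obtain B2 where B2: "\<And>s. Re s \<le> r + C \<Longrightarrow> norm (theta_right b mu s) \<le> B2" using b(6) by blast
  obtain B3 where B3: "\<And>s. Re s \<ge> \<sigma>a \<Longrightarrow> norm (theta_left a lam s) \<le> B3" using a(7) by blast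
  obtain B4 where B4: "\<And>s. Re s \<ge> \<sigma>b \<Longrightarrow> norm (theta_left b mu s) \<le> B4" using b(7) by blast
  have PB: "norm (P s) \<le> norm c0 + norm c1" if "norm s \<ge> 1" "norm (s - of_real r) \<ge> 1" for s
  proof -
    have "norm (c0 / s) \<le> norm c0 / 1" "norm (c1 / (s - of_real r)) \<le> norm c1 / 1"
      unfolding norm_divide using that by (intro divide_left_mono; force)+
    then show ?thesis unfolding P_def by (intro order_trans[OF norm_triangle_ineq]) auto
  qed
  obtain T where T: "\<And>s. - C \<le> Re s \<Longrightarrow> Re s \<le> C \<Longrightarrow> \<bar>Im s\<bar> \<ge> T \<Longrightarrow> norm (E s + P s) < 1"
    using E(4)[of 1 "- C" C] by auto
  define T' where "T' = max T 1"
  have "compact (cbox (Complex (- C) (- T')) (Complex C T'))" by (rule compact_cbox)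
  moreover have "continuous_on (cbox (Complex (- C) (- T')) (Complex C T')) H"
    using Hhol by (intro holomorphic_on_imp_continuous_on) (auto intro: holomorphic_on_subset)
  ultimately have "bounded (H ` cbox (Complex (- C) (- T')) (Complex C T'))"
    by (intro compact_imp_bounded compact_continuous_image)
  then obtain B5 where B5: "\<And>s. s \<in> cbox (Complex (- C) (- T')) (Complex C T') \<Longrightarrow> norm (H s) \<le> B5"
    by (auto simp: bounded_iff)
  define BB where "BB = \<bar>B1\<bar> + \<bar>B2\<bar> + \<bar>B3\<bar> + \<bar>B4\<bar> + \<bar>B5\<bar> + norm c0 + norm c1 + 1"
  have H1: "H s = theta_left a lam s - theta_right b mu (of_real r - s) - P s" if "Re s \<ge> C" for s
    using that C by (simp add: H_def E(2) a(4))
  have "norm (H s) \<le> BB" for s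
  proof -
    \<comment> \<open>Two outer half-planes, the tails of the strip, where \<open>E + P\<close> is
      small, and a compact rectangle.\<close>
    consider "Re s \<ge> C" | "Re s \<le> - C" | "- C \<le> Re s" "Re s \<le> C" "\<bar>Im s\<bar> \<ge> T'"
      | "- C \<le> Re s" "Re s \<le> C" "\<bar>Im s\<bar> \<le> T'"
      by linarith
    then show ?thesis
    proof cases
      case 1
      have "norm (P s) \<le> norm c0 + norm c1"
        using 1 C complex_Re_le_cmod[of s] complex_Re_le_cmod[of "s - of_real r"] by (intro PB) auto
      moreover have "norm (theta_left a lam s) \<le> B3" "norm (theta_right b mu (of_real r - s)) \<le> B2"
        using 1 C r by (auto intro!: B3 B2)
      ultimately show ?thesis
        unfolding H1[OF 1] BB_def
        using norm_triangle_ineq4[of "theta_left a lam s - theta_right b mu (of_real r - s)" "P s"]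
          norm_triangle_ineq4[of "theta_left a lam s" "theta_right b mu (of_real r - s)"] by linarith
    next
      case 2
      have "Re (- s) \<ge> 1" "Re (of_real r - s) \<ge> 1" using 2 C r by auto
      then have "norm (P s) \<le> norm c0 + norm c1"
        using complex_Re_le_cmod[of "- s"] complex_Re_le_cmod[of "of_real r - s"]
        by (intro PB) (auto simp: norm_minus_commute)
      moreover have "norm (theta_left b mu (of_real r - s)) \<le> B4" "norm (theta_right a lam s) \<le> B1"
        using 2 C r by (auto intro!: B4 B1)
      moreover have "H s = theta_left b mu (of_real r - s) - theta_right a lam s - P s"
        using 2 C r by (simp add: H_def E(3) b(4))
      ultimately show ?thesis
        unfolding BB_def
        using norm_triangle_ineq4[of "theta_left b mu (of_real r - s) - theta_right a lam s" "P s"]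
          norm_triangle_ineq4[of "theta_left b mu (of_real r - s)" "theta_right a lam s"] by simp
    next
      case 3
      have "\<bar>Im s\<bar> \<ge> T" "\<bar>Im s\<bar> \<ge> 1" using 3(3) by (auto simp: T'_def)
      then have "norm (P s) \<le> norm c0 + norm c1" "norm (E s + P s) < 1"
        using abs_Im_le_cmod[of s] abs_Im_le_cmod[of "s - of_real r"] 3 by (auto intro!: PB T)
      moreover have "norm (theta_right a lam s) \<le> B1" "norm (theta_right b mu (of_real r - s)) \<le> B2"
        using 3 C r by (auto intro!: B1 B2)
      moreover have "H s = (E s + P s) - P s - theta_right a lam s - theta_right b mu (of_real r - s)"
        by (simp add: H_def)
      ultimately show ?thesis
        unfolding BB_def
        using norm_triangle_ineq4[of "(E s + P s) - P s - theta_right a lam s" "theta_right b mu (of_real r - s)"]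
          norm_triangle_ineq4[of "(E s + P s) - P s" "theta_right a lam s"]
          norm_triangle_ineq4[of "E s + P s" "P s"] by simp
    next
      case 4
      then have "norm (H s) \<le> B5" by (intro B5) (auto simp: in_cbox_complex_iff abs_le_iff)
      then show ?thesis using norm_ge_zero[of c0] norm_ge_zero[of c1] unfolding BB_def by linarith
    qed
  qed
  then have "bounded (range H)" by (auto simp: bounded_iff)
  then obtain \<kappa> where \<kappa>: "\<And>s. H s = \<kappa>"
    using Liouville_theorem[OF Hhol] by (auto simp: constant_on_def)
  define K where "K = nat \<lceil>C\<rceil>"
  show ?thesis
  proof (rule that[of K \<kappa>])
    fix k assume "k \<ge> K"
    then have k: "real k \<ge> C" unfolding K_def by linarith
    let ?ind = "\<lambda>u::real. indicator {..<0} u :: complex"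
    have 1: "has_bochner_integral lborel
        (\<lambda>u. exp (of_nat k * of_real u) * (?ind u * theta a lam (of_real (exp u)))) (theta_left a lam (of_nat k))"
      using a(3)[of "of_nat k"] k C by (simp add: has_bochner_integral_iff theta_left_def)
    \<comment> \<open>The polar terms are integrals over u < 0 as well, that of exp(c u) being 1 /
      c; the second one uses that \<open>k\<close> exceeds \<open>r\<close>.\<close>
    have ex: "has_bochner_integral lborel (\<lambda>u. ?ind u * of_real (exp (c * u))) (of_real (1 / c))" if "c > 0" for c :: real
    proof -
      have "has_bochner_integral lborel (\<lambda>u. complex_of_real (indicator {..<0} u * exp (c * u))) (of_real (1 / c))"
        by (rule has_bochner_integral_of_real[OF exp_integral_left[OF that]])
      moreover have "(\<lambda>u. complex_of_real (indicator {..<0} u * exp (c * u))) = (\<lambda>u. ?ind u * of_real (exp (c * u)))"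
        by (auto simp: fun_eq_iff indicator_def)
      ultimately show ?thesis by simp
    qed
    have 2: "has_bochner_integral lborel (\<lambda>u. ?ind u * of_real (exp (real k * u)) * c0) (of_real (1 / real k) * c0)"
      using k C by (intro has_bochner_integral_mult_left ex) auto
    have 3: "has_bochner_integral lborel (\<lambda>u. ?ind u * of_real (exp ((real k - r) * u)) * c1) (of_real (1 / (real k - r)) * c1)"
      using k C by (intro has_bochner_integral_mult_left ex) auto
    let ?g = "\<lambda>u. exp ((of_real r - of_nat k) * of_real u) * (indicator {0<..} u * theta b mu (of_real (exp u)))"
    \<comment> \<open>The reflection of u to -u carries the right part at \<open>r - k\<close> to an
      integral over u < 0, in which the second theta series has argument exp(-u).\<close>
    have 4: "has_bochner_integral lborel (\<lambda>u. ?g (0 + (- 1) * u)) (theta_right b mu (of_real r - of_nat k))"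
      using lborel_integral_real_affine[of "- 1" ?g 0] lborel_integrable_real_affine[OF b(3), of "- 1" "of_real r - of_nat k" 0]
      by (simp add: has_bochner_integral_iff theta_right_def)
    have "has_bochner_integral lborel (\<lambda>u. exp (of_nat k * of_real u) * (?ind u * theta a lam (of_real (exp u)))
        - ?ind u * of_real (exp (real k * u)) * c0 - ?ind u * of_real (exp ((real k - r) * u)) * c1 - ?g (0 + (- 1) * u))
        (theta_left a lam (of_nat k) - of_real (1 / real k) * c0 - of_real (1 / (real k - r)) * c1
          - theta_right b mu (of_real r - of_nat k))"
      by (intro has_bochner_integral_diff 1 2 3 4)
    moreover have "theta_left a lam (of_nat k) - of_real (1 / real k) * c0 - of_real (1 / (real k - r)) * c1
          - theta_right b mu (of_real r - of_nat k) = \<kappa>"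
      using H1[of "of_nat k"] \<kappa>[of "of_nat k"] k by (simp add: P_def)
    moreover have "exp (of_nat k * of_real u) * (?ind u * theta a lam (of_real (exp u)))
        - ?ind u * of_real (exp (real k * u)) * c0 - ?ind u * of_real (exp ((real k - r) * u)) * c1 - ?g (0 + (- 1) * u)
      = ?ind u * (theta a lam (of_real (exp u)) - c0 - c1 * of_real (exp (- r * u))
       - of_real (exp (- r * u)) * theta b mu (of_real (exp (- u)))) * exp (of_nat k * of_real u)" for u
    proof (cases "u < 0")
      case True
      have e1: "complex_of_real (exp (real k * u)) = exp (of_nat k * of_real u)"
        by (simp flip: exp_of_real)
      have e2: "complex_of_real (exp ((real k - r) * u)) = exp (of_nat k * of_real u) * of_real (exp (- r * u))"
        by (simp add: left_diff_distrib exp_diff exp_minus divide_inverse flip: exp_of_real)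
      have e3: "exp ((complex_of_real r - of_nat k) * of_real (- u)) = exp (of_nat k * of_real u) * of_real (exp (- r * u))"
        unfolding exp_of_real[symmetric] exp_add[symmetric] by (simp add: algebra_simps)
      have e4: "0 + (- 1) * u = - u" by simp
      show ?thesis using True unfolding e4 e1 e2 e3 by (simp add: algebra_simps)
    next
      case False
      then show ?thesis by (simp add: indicator_def)
    qed
    ultimately show "has_bochner_integral lborel
      (\<lambda>u. ?ind u * (theta a lam (of_real (exp u)) - \<Phi> 0
       - Gamma (of_real r) * residue \<Phi> (of_real r) * of_real (exp (- r * u))
       - of_real (exp (- r * u)) * theta b mu (of_real (exp (- u)))) * exp (of_nat k * of_real u)) \<kappa>"
      by (simp only: c0_def c1_def)
  qed
qed

text \<open>The moment argument gives the relation for 0 < z < 1. Both sides are holomorphic in the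
  right half-plane, which inversion preserves, so the identity theorem gives the rest.\<close>

lemma theta_relation:
  assumes A: "class_A r a lam b mu \<Phi> \<Psi>" and z: "Re z > 0"
  shows "theta a lam z = \<Phi> 0 + Gamma (of_real r) * residue \<Phi> (of_real r) * z powr (- of_real r)
           + z powr (- of_real r) * theta b mu (1 / z)"
proof -
  have da: "dirichlet_data a lam" and db: "dirichlet_data b mu"
    using A by (auto simp: class_A_def)
  let ?S = "{z. Re z > 0}"
  define F where "F z = theta a lam z - \<Phi> 0 - Gamma (of_real r) * residue \<Phi> (of_real r) * z powr (- of_real r)
           - z powr (- of_real r) * theta b mu (1 / z)" for z
  define h where "h u = theta a lam (of_real (exp u)) - \<Phi> 0
       - Gamma (of_real r) * residue \<Phi> (of_real r) * of_real (exp (- r * u))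
       - of_real (exp (- r * u)) * theta b mu (of_real (exp (- u)))" for u :: real
  have ch: "continuous_on UNIV h"
    unfolding h_def
    by (intro continuous_intros continuous_theta_exp[OF da]
        continuous_on_compose2[OF continuous_theta_exp[OF db], of _ uminus]) auto
  obtain \<kappa> K where K: "\<And>k. k \<ge> K \<Longrightarrow> has_bochner_integral lborel
      (\<lambda>u. indicator {..<0} u * h u * exp (of_nat k * of_real u)) \<kappa>"
    using hecke_laplace_const[OF A] unfolding h_def by blast
  have h0: "h u = 0" if "u < 0" for u
    by (rule zero_if_laplace_const[OF ch K that])
  have Fh: "F (of_real (exp u)) = h u" for u
    by (simp add: F_def h_def powr_def Ln_of_real exp_minus divide_inverse flip: exp_of_real)
  have hol: "F holomorphic_on ?S"
  proof -
    have inv: "(theta b mu \<circ> (\<lambda>z. 1 / z)) holomorphic_on ?S"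
      using theta_holomorphic[OF db]
      by (intro holomorphic_on_compose_gen[of _ _ _ ?S] holomorphic_intros)
         (auto simp: Re_divide complex_eq_iff sum_power2_gt_zero_iff divide_pos_pos)
    show ?thesis unfolding F_def
      using inv theta_holomorphic[OF da]
      by (intro holomorphic_intros) (auto simp: o_def complex_nonpos_Reals_iff)
  qed
  have "F z = 0"
  proof (rule analytic_continuation[OF hol open_halfspace_Re_gt])
    show "connected ?S" by (intro convex_connected convex_halfspace_Re_gt)
    show "of_real ` {0<..<1} \<subseteq> ?S" by auto
    show "1 / 2 \<in> ?S" by simp
    show "(1 / 2 :: complex) islimpt of_real ` {0<..<1}"
      unfolding islimpt_approachable
    proof (intro allI impI)
      fix e :: real assume "e > 0"
      define t where "t = 1 / 2 + min e 1 / 4"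
      have "0 < t" "t < 1" "t \<noteq> 1 / 2" "\<bar>t - 1 / 2\<bar> < e" using \<open>e > 0\<close> by (auto simp: t_def min_def)
      moreover have "dist (complex_of_real t) (1 / 2) = \<bar>t - 1 / 2\<bar>"
        using dist_of_real[of t "1 / 2", where 'a = complex] by (simp add: dist_real_def)
      moreover have "complex_of_real t \<noteq> 1 / 2" using \<open>t \<noteq> 1 / 2\<close> of_real_eq_iff[of t "1 / 2", where 'a = complex] by simp
      ultimately show "\<exists>x\<in>of_real ` {0<..<1}. x \<noteq> (1 / 2 :: complex) \<and> dist x (1 / 2) < e"
        by (intro bexI[of _ "of_real t"]) auto
    qed
    show "F x = 0" if "x \<in> of_real ` {0<..<1}" for x
    proof -
      from that obtain t where t: "0 < t" "t < 1" "x = of_real t" by auto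
      then show ?thesis using Fh[of "ln t"] h0[of "ln t"] by simp
    qed
  qed (use z in auto)
  then show ?thesis by (simp add: F_def algebra_simps)
qed

section \<open>Bessel series\<close>

text \<open>On this disc both z = \<alpha> (1 + v) and 1 / z keep half of their central real part,
  so both theta series have summable majorants independent of \<open>v\<close>.\<close>

lemma right_half_plane_ball:
  assumes "Re \<alpha> > 0"
  obtains \<delta> where "\<delta> > 0" "\<delta> \<le> 1 / 2" "\<And>v. norm v < \<delta> \<Longrightarrow> Re (\<alpha> * (1 + v)) \<ge> Re \<alpha> / 2"
    "\<And>v. norm v < \<delta> \<Longrightarrow> Re (1 / (\<alpha> * (1 + v))) \<ge> Re (1 / \<alpha>) / 2"
proof -
  have \<alpha>: "\<alpha> \<noteq> 0" using assms by auto
  define c where "c = Re (1 / \<alpha>)"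
  have c: "c > 0" using assms \<alpha>
    by (simp add: c_def Re_divide complex_eq_iff sum_power2_gt_zero_iff divide_pos_pos)
  \<comment> \<open>The three bounds give norm at least 1/2 for 1 + v, norm at most Re \<alpha> / 2
    for \<alpha> v, and norm at most c / 2 for the change of 1 / z, which is v / (1 + v) divided by
    \<alpha>, up to sign.\<close>
  define \<delta> where "\<delta> = min (1 / 2) (min (Re \<alpha> / (2 * norm \<alpha>)) (c / (4 * norm (1 / \<alpha>))))"
  show ?thesis
  proof (rule that[of \<delta>])
    show "\<delta> > 0" "\<delta> \<le> 1 / 2" using \<alpha> assms c by (auto simp: \<delta>_def)
    fix v :: complex assume v: "norm v < \<delta>"
    have "norm (\<alpha> * v) \<le> Re \<alpha> / 2"
      using v \<alpha> by (simp add: \<delta>_def norm_mult field_simps)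
    then have "- Re (\<alpha> * v) \<le> Re \<alpha> / 2" using complex_Re_le_cmod[of "- (\<alpha> * v)"] by simp
    then show "Re (\<alpha> * (1 + v)) \<ge> Re \<alpha> / 2" by (simp add: distrib_left)
    have nv: "norm v < 1 / 2" using v by (simp add: \<delta>_def)
    then have n1: "norm (1 + v) \<ge> 1 / 2" using norm_diff_ineq[of 1 v] by simp
    then have nz: "1 + v \<noteq> 0" by auto
    have "1 / (1 + v) = 1 - v / (1 + v)" using nz by (simp add: field_simps)
    then have "1 / \<alpha> * (1 / (1 + v)) = 1 / \<alpha> * (1 - v / (1 + v))" by simp
    then have eq: "1 / (\<alpha> * (1 + v)) = 1 / \<alpha> - 1 / \<alpha> * (v / (1 + v))"
      by (simp add: right_diff_distrib)
    have "norm (v / (1 + v)) \<le> norm v / (1 / 2)"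
      unfolding norm_divide using n1 by (intro divide_left_mono) auto
    also have "\<dots> \<le> 2 * (c / (4 * norm (1 / \<alpha>)))" using v by (simp add: \<delta>_def)
    finally have "norm (1 / \<alpha>) * norm (v / (1 + v)) \<le> norm (1 / \<alpha>) * (2 * (c / (4 * norm (1 / \<alpha>))))"
      by (intro mult_left_mono) auto
    also have "\<dots> = c / 2" using \<alpha> by simp
    finally have "Re (1 / \<alpha> * (v / (1 + v))) \<le> c / 2"
      using complex_Re_le_cmod[of "1 / \<alpha> * (v / (1 + v))"] norm_mult[of "1 / \<alpha>" "v / (1 + v)"] by linarith
    then show "Re (1 / (\<alpha> * (1 + v))) \<ge> Re (1 / \<alpha>) / 2"
      unfolding eq minus_complex.sel c_def by linarith
  qed
qed

text \<open>The two sides of the modular relation at \<open>\<alpha> * (1 + v)\<close> agree as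
  germs in \<open>v\<close>, so their transforms agree, and each side can be transformed term by
  term.\<close>

lemma bessel_series_transformation:
  assumes A: "class_A r a lam b mu \<Phi> \<Psi>" and \<alpha>: "Re \<alpha> > 0"
  shows "summable (\<lambda>n. a n * exp (- \<alpha> * of_real (lam n)) * bessel_series r (- of_real (lam n) * w))" (is "summable ?L")
    and "summable (\<lambda>n. b n * exp (- of_real (mu n) / \<alpha>) * bessel_series r (of_real (mu n) * w / \<alpha>\<^sup>2))" (is "summable ?R")
    and "(\<Sum>n. a n * exp (- \<alpha> * of_real (lam n)) * bessel_series r (- of_real (lam n) * w)) =
      \<Phi> 0 / Gamma (of_real r) + \<alpha> powr (- of_real r) * residue \<Phi> (of_real r) * exp (- w / \<alpha>)
      + \<alpha> powr (- of_real r) * exp (- w / \<alpha>) *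
        (\<Sum>n. b n * exp (- of_real (mu n) / \<alpha>) * bessel_series r (of_real (mu n) * w / \<alpha>\<^sup>2))"
proof -
  have r: "r > 0" and da: "dirichlet_data a lam" and db: "dirichlet_data b mu"
    using A by (auto simp: class_A_def)
  have \<alpha>0: "\<alpha> \<noteq> 0" using \<alpha> by auto
  have lam: "lam n > 0" and mu: "mu n > 0" for n using da db by (auto simp: dirichlet_data_def)
  obtain \<delta> where \<delta>: "\<delta> > 0" "\<delta> \<le> 1 / 2" "\<And>v. norm v < \<delta> \<Longrightarrow> Re (\<alpha> * (1 + v)) \<ge> Re \<alpha> / 2"
    "\<And>v. norm v < \<delta> \<Longrightarrow> Re (1 / (\<alpha> * (1 + v))) \<ge> Re (1 / \<alpha>) / 2"
    using right_half_plane_ball[OF \<alpha>] by metis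
  have re: "Re (1 / \<alpha>) > 0" using \<alpha> \<alpha>0
    by (simp add: Re_divide complex_eq_iff sum_power2_gt_zero_iff divide_pos_pos)
  have v1: "norm (1 + v) \<ge> 1 / 2" "Re (1 + v) > 0" "1 + v \<noteq> 0" if "norm v < \<delta>" for v :: complex
  proof -
    have "norm v < 1 / 2" using that \<delta>(2) by linarith
    then show "norm (1 + v) \<ge> 1 / 2" "Re (1 + v) > 0"
      using norm_diff_ineq[of 1 v] complex_Re_le_cmod[of "- v"] by auto
    then show "1 + v \<noteq> 0" by auto
  qed
  \<comment> \<open>With this scaling x = \<alpha> \<open>lam n\<close> gives x \<open>?W\<close> =
    \<open>lam n * w\<close>, and x = \<open>mu n / \<alpha>\<close> gives x \<open>?W\<close> =
    \<open>mu n * w / \<alpha>\<^sup>2\<close>: the arguments in the two series, up to sign.\<close>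
  let ?W = "w / \<alpha>"
  let ?\<gamma> = "gamma_weight r"
  let ?B = "bessel_series r"
  define f where "f n v = a n * exp (- (\<alpha> * of_real (lam n)) * (1 + v))" for n v
  define g where "g n v = b n * ((1 + v) powr (- of_real r) * exp (- (of_real (mu n) / \<alpha>) / (1 + v)))" for n v
  have fhol: "f n holomorphic_on ball 0 \<delta>" for n unfolding f_def by (intro holomorphic_intros)
  have nonpos: "1 + v \<notin> \<real>\<^sub>\<le>\<^sub>0" if "norm v < \<delta>" for v :: complex
    using v1(2)[OF that] by (simp add: complex_nonpos_Reals_iff)
  have ghol: "g n holomorphic_on ball 0 \<delta>" for n
    unfolding g_def using nonpos v1(3) by (intro holomorphic_intros) auto
  have fb: "norm (f n v) \<le> norm (a n) * exp (- (Re \<alpha> / 2) * lam n)" if "norm v < \<delta>" for n v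
  proof -
    have "norm (f n v) = norm (a n) * exp (- Re (\<alpha> * (1 + v)) * lam n)"
      unfolding f_def norm_mult norm_exp_eq_Re by (simp add: algebra_simps)
    also have "\<dots> \<le> norm (a n) * exp (- (Re \<alpha> / 2) * lam n)"
    proof -
      have "- Re (\<alpha> * (1 + v)) * lam n \<le> - (Re \<alpha> / 2) * lam n"
        using \<delta>(3)[OF that] lam[of n] by (intro mult_right_mono) auto
      then show ?thesis by (intro mult_left_mono) auto
    qed
    finally show ?thesis .
  qed
  have gb: "norm (g n v) \<le> norm (b n) * exp (- (Re (1 / \<alpha>) / 2) * mu n) * 2 powr r" if v: "norm v < \<delta>" for n v
  proof -
    have "norm ((1 + v) powr (- complex_of_real r)) = norm (1 + v) powr (- r)"
      using v1[OF v] by (subst norm_powr_real_powr') auto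
    also have "\<dots> \<le> (1 / 2) powr (- r)" using v1[OF v] r by (intro powr_mono2') auto
    also have "\<dots> = 2 powr r" by (simp add: powr_minus powr_divide)
    finally have 1: "norm ((1 + v) powr (- complex_of_real r)) \<le> 2 powr r" .
    have "- (of_real (mu n) / \<alpha>) / (1 + v) = of_real (- mu n) * (1 / (\<alpha> * (1 + v)))" by simp
    then have "norm (exp (- (of_real (mu n) / \<alpha>) / (1 + v))) = exp (- mu n * Re (1 / (\<alpha> * (1 + v))))"
      by (simp only: norm_exp_eq_Re times_complex.sel Re_complex_of_real Im_complex_of_real mult_zero_left diff_zero)
    also have "\<dots> \<le> exp (- (Re (1 / \<alpha>) / 2) * mu n)"
    proof -
      have "- Re (1 / (\<alpha> * (1 + v))) * mu n \<le> - (Re (1 / \<alpha>) / 2) * mu n"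
        using \<delta>(4)[OF v] mu[of n] by (intro mult_right_mono) auto
      then show ?thesis by (simp add: mult_ac)
    qed
    finally have "norm (g n v) \<le> norm (b n) * (2 powr r * exp (- (Re (1 / \<alpha>) / 2) * mu n))"
      unfolding g_def norm_mult using 1 by (intro mult_left_mono mult_mono) auto
    then show ?thesis by (simp add: mult_ac)
  qed
  have fct: "coeff_transform ?\<gamma> (f n) ?W (?L n)" for n
  proof -
    have "coeff_transform ?\<gamma> (f n) ?W
        (a n * (exp (- (\<alpha> * of_real (lam n))) * ?B (- (\<alpha> * of_real (lam n)) * ?W)))"
      unfolding f_def by (intro coeff_transform_cmult coeff_transform_exp r)
    then show ?thesis using \<alpha>0 by (simp add: mult_ac)
  qed
  have gct: "coeff_transform ?\<gamma> (g n) ?W (exp (- w / \<alpha>) * ?R n)" for n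
  proof -
    have "coeff_transform ?\<gamma> (g n) ?W
        (b n * (exp (- (of_real (mu n) / \<alpha>)) * exp (- ?W) * ?B (of_real (mu n) / \<alpha> * ?W)))"
      unfolding g_def by (intro coeff_transform_cmult coeff_transform_exp_inverse r)
    then show ?thesis using \<alpha>0 by (simp add: mult_ac power2_eq_square)
  qed
  have sa: "summable (\<lambda>n. norm (a n) * exp (- (Re \<alpha> / 2) * lam n))"
    using summable_theta[OF da, of "Re \<alpha> / 2"] \<alpha> by simp
  have sb: "summable (\<lambda>n. norm (b n) * exp (- (Re (1 / \<alpha>) / 2) * mu n) * 2 powr r)"
    using summable_theta[OF db, of "Re (1 / \<alpha>) / 2"] re by (intro summable_mult2) simp
  note F = coeff_transform_suminf[OF \<delta>(1) fhol fb sa rGamma_weights_summable[OF r] fct]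
  note G = coeff_transform_suminf[OF \<delta>(1) ghol gb sb rGamma_weights_summable[OF r] gct]
  have F2: "coeff_transform ?\<gamma> (\<lambda>v. \<Sum>n. f n v) ?W (suminf ?L)" by (rule F(2))
  have G1: "summable (\<lambda>n. exp (- w / \<alpha>) * ?R n)" by (rule G(1))
  have G2: "coeff_transform ?\<gamma> (\<lambda>v. \<Sum>n. g n v) ?W (\<Sum>n. exp (- w / \<alpha>) * ?R n)" by (rule G(2))
  show "summable ?L" by (rule F(1))
  show sR: "summable ?R" using G1 by (subst (asm) summable_cmult_iff) auto
  define c1 where "c1 = Gamma (of_real r) * residue \<Phi> (of_real r)"
  have bin: "coeff_transform ?\<gamma> (\<lambda>v. (1 + v) powr (- of_real r)) ?W (rGamma (of_real r) * exp (- w / \<alpha>))"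
    using coeff_transform_binomial[OF r, of 0 ?W] by simp
  have const: "coeff_transform ?\<gamma> (\<lambda>v. \<Phi> 0) ?W (rGamma (of_real r) * \<Phi> 0)"
    using coeff_transform_const[of ?\<gamma> "\<Phi> 0" ?W] by simp
  note rhs = coeff_transform_add[OF coeff_transform_add[OF const
      coeff_transform_cmult[OF bin, of "c1 * \<alpha> powr (- of_real r)"]]
      coeff_transform_cmult[OF G2, of "\<alpha> powr (- of_real r)"]]
  have ev: "eventually (\<lambda>v. (\<Sum>n. f n v) = \<Phi> 0 + c1 * \<alpha> powr (- of_real r) * (1 + v) powr (- of_real r)
      + \<alpha> powr (- of_real r) * (\<Sum>n. g n v)) (nhds 0)"
    unfolding eventually_nhds_metric
  proof (intro exI[of _ \<delta>] conjI allI impI \<delta>(1))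
    fix v :: complex assume "dist v 0 < \<delta>"
    then have v: "norm v < \<delta>" by simp
    let ?z = "\<alpha> * (1 + v)"
    have "Re ?z > 0" using \<delta>(3)[OF v] \<alpha> by linarith
    note rel = theta_relation[OF A this]
    have pw: "?z powr (- of_real r) = \<alpha> powr (- of_real r) * (1 + v) powr (- of_real r)"
      using \<alpha> v1[OF v] by (intro powr_mult_right_half_plane) auto
    have "(\<Sum>n. f n v) = theta a lam ?z"
      unfolding theta_def f_def by (intro suminf_cong) (simp add: algebra_simps)
    moreover have "(\<Sum>n. g n v) = (1 + v) powr (- of_real r) * theta b mu (1 / ?z)"
    proof -
      have "Re (1 / ?z) > 0" using \<delta>(4)[OF v] re by linarith
      then have "summable (\<lambda>n. norm (b n * exp (- (1 / ?z) * of_real (mu n))))"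
      proof -
        have "norm (exp (- u * of_real m)) = exp (- Re u * m)" for u :: complex and m :: real by simp
        then show ?thesis using summable_theta[OF db \<open>Re (1 / ?z) > 0\<close>] by (simp only: norm_mult)
      qed
      then have "summable (\<lambda>n. b n * exp (- (1 / ?z) * of_real (mu n)))" by (rule summable_norm_cancel)
      then have "(1 + v) powr (- of_real r) * theta b mu (1 / ?z)
          = (\<Sum>n. (1 + v) powr (- of_real r) * (b n * exp (- (1 / ?z) * of_real (mu n))))"
        unfolding theta_def by (rule suminf_mult[symmetric])
      also have "\<dots> = (\<Sum>n. g n v)"
        unfolding g_def by (intro suminf_cong) simp
      finally show ?thesis by simp
    qed
    ultimately show "(\<Sum>n. f n v) = \<Phi> 0 + c1 * \<alpha> powr (- of_real r) * (1 + v) powr (- of_real r)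
      + \<alpha> powr (- of_real r) * (\<Sum>n. g n v)"
      unfolding rel pw c1_def by (simp add: mult_ac)
  qed
  have "suminf ?L = rGamma (of_real r) * \<Phi> 0 + c1 * \<alpha> powr (- of_real r) * (rGamma (of_real r) * exp (- w / \<alpha>))
      + \<alpha> powr (- of_real r) * (\<Sum>n. exp (- w / \<alpha>) * ?R n)"
    by (rule coeff_transform_unique[OF F2 rhs ev])
  moreover have "(\<Sum>n. exp (- w / \<alpha>) * ?R n) = exp (- w / \<alpha>) * suminf ?R"
    by (rule suminf_mult[OF sR])
  \<comment> \<open>The zeroth weight cancels Gamma(r) in the polar term and leaves the bare
    residue.\<close>
  moreover have "Gamma (complex_of_real r) \<noteq> 0"
    using r by (simp add: Gamma_complex_of_real Gamma_real_pos less_imp_neq[symmetric])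
  then have "c1 * rGamma (of_real r) = residue \<Phi> (of_real r)"
    by (simp add: c1_def rGamma_inverse_Gamma)
  ultimately show "suminf ?L = \<Phi> 0 / Gamma (of_real r) + \<alpha> powr (- of_real r) * residue \<Phi> (of_real r) * exp (- w / \<alpha>)
      + \<alpha> powr (- of_real r) * exp (- w / \<alpha>) * suminf ?R"
    by (simp add: rGamma_inverse_Gamma divide_inverse mult_ac)
qed

section \<open>Branches of the powers in the Bessel functions\<close>

lemma cpow_mult_pos:
  assumes "t > 0"
  shows "cpow (z * of_real t) \<nu> = cpow z \<nu> * of_real t powr \<nu>"
proof (cases "z = 0")
  case False
  then have "Ln (z * of_real t) = Ln z + of_real (ln t)"
    using Ln_times_of_real[OF assms, of z] assms by (simp add: mult.commute Ln_of_real)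
  then show ?thesis
    using False assms by (simp add: cpow_def powr_def Ln_of_real exp_add[symmetric] algebra_simps)
qed (use assms in \<open>auto simp: cpow_def\<close>)

text \<open>The normalising power of \<open>l\<close> cancels the dependence of the Bessel prefactor
  on \<open>l\<close>, leaving a constant that can be taken out of the series. No branch changes,
  because \<open>sqrt l / 2\<close> is positive.\<close>

lemma cpow_sqrt_half:
  fixes r l :: real
  assumes "l > 0"
  shows "of_real (l powr ((1 - r) / 2)) * cpow (\<beta> * of_real (sqrt l) / 2) (of_real (r - 1))
    = cpow \<beta> (of_real (r - 1)) / 2 powr of_real (r - 1)"
proof -
  have s: "sqrt l / 2 > 0" using assms by simp
  have "cpow (\<beta> * of_real (sqrt l) / 2) (of_real (r - 1))
      = cpow \<beta> (of_real (r - 1)) * of_real ((sqrt l / 2) powr (r - 1))"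
  proof -
    have "\<beta> * of_real (sqrt l) / 2 = \<beta> * complex_of_real (sqrt l / 2)" by simp
    moreover have "complex_of_real (sqrt l / 2) powr of_real (r - 1) = of_real ((sqrt l / 2) powr (r - 1))"
      using s by (intro powr_of_real) auto
    ultimately show ?thesis by (simp only: cpow_mult_pos[OF s])
  qed
  also have "(sqrt l / 2) powr (r - 1) = l powr ((r - 1) / 2) / 2 powr (r - 1)"
    using assms by (simp add: powr_divide powr_half_sqrt[symmetric] powr_powr)
  finally have "of_real (l powr ((1 - r) / 2)) * cpow (\<beta> * of_real (sqrt l) / 2) (of_real (r - 1))
     = cpow \<beta> (of_real (r - 1)) * of_real (l powr ((1 - r) / 2) * l powr ((r - 1) / 2) / 2 powr (r - 1))"
    by simp
  also have "l powr ((1 - r) / 2) * l powr ((r - 1) / 2) = 1"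
    using assms by (simp add: powr_add[symmetric] diff_divide_distrib)
  also have "complex_of_real (1 / 2 powr (r - 1)) = 1 / 2 powr of_real (r - 1)"
    using powr_of_real[of 2 "r - 1"] by simp
  finally show ?thesis by simp
qed

lemma bessel_J_term:
  fixes r l :: real
  assumes "l > 0"
  shows "of_real (l powr ((1 - r) / 2)) * bessel_J (of_real (r - 1)) (\<beta> * of_real (sqrt l))
    = cpow \<beta> (of_real (r - 1)) / 2 powr of_real (r - 1) * bessel_series r (- of_real l * (\<beta>\<^sup>2 / 4))"
proof -
  have "(\<beta> * of_real (sqrt l) / 2)\<^sup>2 = of_real l * (\<beta>\<^sup>2 / 4)"
    using assms by (simp add: power_mult_distrib power_divide mult.commute flip: of_real_power)
  then have "(\<beta> * of_real (sqrt l) / 2) ^ (2 * k) = (of_real l * (\<beta>\<^sup>2 / 4)) ^ k" for k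
    by (simp only: power_mult)
  then have ser: "(- 1) ^ k * rGamma (of_real (r - 1) + of_nat k + 1) / fact k * (\<beta> * of_real (sqrt l) / 2) ^ (2 * k)
      = rGamma (of_real r + of_nat k) / fact k * (- of_real l * (\<beta>\<^sup>2 / 4)) ^ k" for k
    using power_minus[of "of_real l * (\<beta>\<^sup>2 / 4)" k] by (simp add: add_ac)
  then show ?thesis
    unfolding cpow_sqrt_half[OF assms, symmetric] bessel_J_def bessel_series_def ser
    by (simp only: mult_ac)
qed

lemma bessel_I_quot_term:
  fixes r l :: real
  assumes "l > 0"
  shows "of_real (l powr ((1 - r) / 2)) * bessel_I_quot (of_real (r - 1)) (\<beta> * of_real (sqrt l)) \<alpha>
    = cpow \<beta> (of_real (r - 1)) / 2 powr of_real (r - 1) / \<alpha> powr of_real (r - 1)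
      * bessel_series r (of_real l * (\<beta>\<^sup>2 / 4) / \<alpha>\<^sup>2)"
proof -
  have "(\<beta> * of_real (sqrt l) / \<alpha> / 2)\<^sup>2 = of_real l * (\<beta>\<^sup>2 / 4) / \<alpha>\<^sup>2"
    using assms by (simp add: power_mult_distrib power_divide mult_ac flip: of_real_power)
  then have "(\<beta> * of_real (sqrt l) / \<alpha> / 2) ^ (2 * k) = (of_real l * (\<beta>\<^sup>2 / 4) / \<alpha>\<^sup>2) ^ k" for k
    by (simp only: power_mult)
  then have ser: "rGamma (of_real (r - 1) + of_nat k + 1) / fact k * (\<beta> * of_real (sqrt l) / \<alpha> / 2) ^ (2 * k)
      = rGamma (of_real r + of_nat k) / fact k * (of_real l * (\<beta>\<^sup>2 / 4) / \<alpha>\<^sup>2) ^ k" for k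
    by (simp add: add_ac)
  then show ?thesis
    unfolding cpow_sqrt_half[OF assms, symmetric] bessel_I_quot_def bessel_I_branch_def bessel_series_def ser
    by (simp only: times_divide_eq_left times_divide_eq_right mult_ac)
qed

text \<open>For integer \<open>r\<close> the order is a natural number and its powers have no
  branches. Otherwise the bound on the arguments makes the logarithm of the quotient equal to the
  difference of the logarithms.\<close>

lemma bessel_I_eq_quot:
  fixes r l :: real
  assumes "r > 0" "l > 0" "Re \<alpha> > 0" "r \<in> \<int> \<or> - pi < Arg \<beta> - Arg \<alpha> \<and> Arg \<beta> - Arg \<alpha> \<le> pi"
  shows "bessel_I (of_real (r - 1)) (\<beta> * of_real (sqrt l) / \<alpha>)
    = bessel_I_quot (of_real (r - 1)) (\<beta> * of_real (sqrt l)) \<alpha>"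
proof -
  let ?\<nu> = "complex_of_real (r - 1)"
  have \<alpha>: "\<alpha> \<noteq> 0" using assms(3) by auto
  have s: "sqrt l / 2 > 0" using assms(2) by simp
  have "cpow (\<beta> / \<alpha>) ?\<nu> = cpow \<beta> ?\<nu> / \<alpha> powr ?\<nu>"
  proof (cases "\<beta> = 0")
    case False
    show ?thesis
    proof (cases "r \<in> \<int>")
      case True
      then obtain k :: int where "r = of_int k" by (auto elim: Ints_cases)
      \<comment> \<open>Positivity of \<open>r\<close> makes \<open>k - 1\<close> nonnegative, so
        \<open>nat\<close> loses nothing.\<close>
      with assms(1) have "?\<nu> = of_nat (nat (k - 1))" by simp
      then show ?thesis using False \<alpha> by (simp add: cpow_def powr_nat power_divide)
    next
      case nint: False
      have "Ln (\<beta> / \<alpha>) = Ln \<beta> - Ln \<alpha>"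
        using assms(4) nint False \<alpha> by (intro Ln_unique) (auto simp: exp_diff Arg_def)
      then have "(\<beta> / \<alpha>) powr s = \<beta> powr s / \<alpha> powr s" for s
        using False \<alpha> by (simp add: powr_def right_diff_distrib exp_diff)
      then show ?thesis using False \<alpha> by (simp add: cpow_def)
    qed
  qed (use \<alpha> in \<open>auto simp: cpow_def\<close>)
  then have "cpow (\<beta> * of_real (sqrt l) / \<alpha> / 2) ?\<nu> = cpow (\<beta> * of_real (sqrt l) / 2) ?\<nu> / \<alpha> powr ?\<nu>"
    using cpow_mult_pos[OF s, of "\<beta> / \<alpha>" ?\<nu>] cpow_mult_pos[OF s, of \<beta> ?\<nu>] by (simp add: mult_ac)
  then show ?thesis by (simp add: bessel_I_def bessel_I_quot_def)
qed

text \<open>The identity comes first with the power continued analytically in \<alpha>, which covers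
  every \<beta>, since the principal power of the quotient \<beta> / \<alpha> may jump by a factor.
  The principal \<open>bessel_I\<close> is then recovered under a condition that makes the two
  agree.\<close>

theorem theorem2p1:
  fixes r :: real and a b :: "nat \<Rightarrow> complex" and lam mu :: "nat \<Rightarrow> real"
    and \<Phi> \<Psi> :: "complex \<Rightarrow> complex" and \<rho> \<alpha> \<beta> :: complex
  assumes "class_A r a lam b mu \<Phi> \<Psi>"
    and "\<rho> = residue \<Phi> (of_real r)"
    and "Re \<alpha> > 0"
  shows
    "summable (\<lambda>n. a n * of_real (lam n powr ((1 - r) / 2)) * exp (- \<alpha> * of_real (lam n)) *
        bessel_J (of_real (r - 1)) (\<beta> * of_real (sqrt (lam n)))) \<and>
     summable (\<lambda>n. b n * of_real (mu n powr ((1 - r) / 2)) * exp (- of_real (mu n) / \<alpha>) *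
        bessel_I_quot (of_real (r - 1)) (\<beta> * of_real (sqrt (mu n))) \<alpha>) \<and>
     (\<Sum>n. a n * of_real (lam n powr ((1 - r) / 2)) * exp (- \<alpha> * of_real (lam n)) *
        bessel_J (of_real (r - 1)) (\<beta> * of_real (sqrt (lam n)))) =
       \<Phi> 0 * cpow \<beta> (of_real (r - 1)) / (2 powr of_real (r - 1) * Gamma (of_real r))
       + cpow \<beta> (of_real (r - 1)) * \<rho> / (2 powr of_real (r - 1) * \<alpha> powr of_real r)
           * exp (- \<beta>\<^sup>2 / (4 * \<alpha>))
       + exp (- \<beta>\<^sup>2 / (4 * \<alpha>)) / \<alpha> *
           (\<Sum>n. b n * of_real (mu n powr ((1 - r) / 2)) * exp (- of_real (mu n) / \<alpha>) *
              bessel_I_quot (of_real (r - 1)) (\<beta> * of_real (sqrt (mu n))) \<alpha>) \<and>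
     (r \<in> \<int> \<or> - pi < Arg \<beta> - Arg \<alpha> \<and> Arg \<beta> - Arg \<alpha> \<le> pi \<longrightarrow>
       summable (\<lambda>n. b n * of_real (mu n powr ((1 - r) / 2)) * exp (- of_real (mu n) / \<alpha>) *
          bessel_I (of_real (r - 1)) (\<beta> * of_real (sqrt (mu n)) / \<alpha>)) \<and>
       (\<Sum>n. a n * of_real (lam n powr ((1 - r) / 2)) * exp (- \<alpha> * of_real (lam n)) *
          bessel_J (of_real (r - 1)) (\<beta> * of_real (sqrt (lam n)))) =
         \<Phi> 0 * cpow \<beta> (of_real (r - 1)) / (2 powr of_real (r - 1) * Gamma (of_real r))
         + cpow \<beta> (of_real (r - 1)) * \<rho> / (2 powr of_real (r - 1) * \<alpha> powr of_real r)
             * exp (- \<beta>\<^sup>2 / (4 * \<alpha>))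
         + exp (- \<beta>\<^sup>2 / (4 * \<alpha>)) / \<alpha> *
             (\<Sum>n. b n * of_real (mu n powr ((1 - r) / 2)) * exp (- of_real (mu n) / \<alpha>) *
                bessel_I (of_real (r - 1)) (\<beta> * of_real (sqrt (mu n)) / \<alpha>)))"
    (is "summable ?J \<and> summable ?Q \<and> suminf ?J = ?R + ?e * suminf ?Q \<and> (?arg \<longrightarrow> summable ?I \<and> _)")
proof -
  have r: "r > 0" and lam: "\<And>n. lam n > 0" and mu: "\<And>n. mu n > 0"
    using assms(1) by (auto simp: class_A_def dirichlet_data_def)
  have \<alpha>: "\<alpha> \<noteq> 0" using assms(3) by auto
  \<comment> \<open>The factor from \<beta> common to all terms; what follows is \<kappa> times the
    identity for \<open>bessel_series\<close>.\<close>
  define \<kappa> where "\<kappa> = cpow \<beta> (of_real (r - 1)) / 2 powr of_real (r - 1)"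
  define w where "w = \<beta>\<^sup>2 / 4"
  define L where "L n = a n * exp (- \<alpha> * of_real (lam n)) * bessel_series r (- of_real (lam n) * w)" for n
  define R where "R n = b n * exp (- of_real (mu n) / \<alpha>) * bessel_series r (of_real (mu n) * w / \<alpha>\<^sup>2)" for n
  note core = bessel_series_transformation[OF assms(1,3), of w, folded L_def R_def]
  have J: "?J = (\<lambda>n. \<kappa> * L n)"
  proof
    fix n
    have "?J n = a n * exp (- \<alpha> * of_real (lam n)) * (of_real (lam n powr ((1 - r) / 2)) *
        bessel_J (of_real (r - 1)) (\<beta> * of_real (sqrt (lam n))))" by (simp only: mult_ac)
    then show "?J n = \<kappa> * L n" unfolding bessel_J_term[OF lam] L_def \<kappa>_def w_def by (simp only: mult_ac)
  qed
  have Q: "?Q = (\<lambda>n. \<kappa> / \<alpha> powr of_real (r - 1) * R n)"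
  proof
    fix n
    have "?Q n = b n * exp (- of_real (mu n) / \<alpha>) * (of_real (mu n powr ((1 - r) / 2)) *
        bessel_I_quot (of_real (r - 1)) (\<beta> * of_real (sqrt (mu n))) \<alpha>)" by (simp only: mult_ac)
    then show "?Q n = \<kappa> / \<alpha> powr of_real (r - 1) * R n"
      unfolding bessel_I_quot_term[OF mu] R_def \<kappa>_def w_def by (simp only: mult_ac)
  qed
  have sJ: "summable ?J" unfolding J by (intro summable_mult core)
  have sQ: "summable ?Q" unfolding Q by (intro summable_mult core)
  have w\<alpha>: "- w / \<alpha> = - \<beta>\<^sup>2 / (4 * \<alpha>)" by (simp add: w_def)
  \<comment> \<open>The first equation accounts for the factor 1 / \<alpha> before the second
    series: the Bessel prefactor has exponent \<open>r - 1\<close>, the modular relation has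
    \<open>r\<close>.\<close>
  have p: "\<alpha> powr of_real (r - 1) * \<alpha> = \<alpha> powr of_real r" "\<alpha> powr (- of_real r) = 1 / \<alpha> powr of_real r"
    using \<alpha> by (simp_all add: powr_diff powr_minus divide_inverse)
  have "suminf ?J = \<kappa> * suminf L" unfolding J by (rule suminf_mult[OF core(1)])
  also have "\<dots> = \<kappa> * (\<Phi> 0 / Gamma (of_real r)) + \<kappa> * \<rho> / \<alpha> powr of_real r * exp (- \<beta>\<^sup>2 / (4 * \<alpha>))
      + exp (- \<beta>\<^sup>2 / (4 * \<alpha>)) * (\<kappa> / \<alpha> powr of_real r * suminf R)"
    unfolding core(3) w\<alpha> p(2) assms(2) by (simp add: distrib_left mult_ac)
  also have "\<kappa> / \<alpha> powr of_real r * suminf R = suminf ?Q / \<alpha>"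
    unfolding Q suminf_mult[OF core(2)] p(1)[symmetric] by simp
  finally have main: "suminf ?J = ?R + ?e * suminf ?Q" by (simp add: \<kappa>_def mult_ac)
  have "?I = ?Q" if ?arg
    using bessel_I_eq_quot[OF r mu assms(3) that] by simp
  then show ?thesis using sJ sQ main by simp
qed

end
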